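(* Let $n\ge 4$ and let $\widetilde W$ be the extended affine Weyl group of type $\mathsf D_n^{(1)}$. If $i\in\{1,\dots,n\}$ is even, then $$\omega_i=\begin{cases}\big(s_0[2,n-1][1,n-2]s_n\big)^{i/2}\,[n-i,n-1]\cdots[1,i] & 2\le i\le n-2,\\ \pi_{n-1}\,r_{n-2}r_{n-4}\cdots r_3\, s_n[1,n-1] & i=n-1,\\ \pi_n\, r_{n-2}r_{n-4}\cdots r_2\, s_n & i=n.\end{cases}$$ If $i$ is odd, then $$\omega_i=\begin{cases}\pi_1[1,n-2]s_n\big(s_0[2,n-1][1,n-2]s_n\big)^{(i-1)/2}[n-i,n-1]\cdots[1,i] & 1\le i\le n-2,\\ \pi_{n-1}\,s_{n-1}s_{n-2}\,r_{n-3}r_{n-5}\cdots r_3\,s_n[1,n-1] & i=n-1,\\ \pi_n\, s_{n-1}s_{n-2}\,r_{n-3}r_{n-5}\cdots r_2\, s_n & i=n.\end{cases}$$ Moreover, the formulae above yield reduced expressions.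
   Context: Let $\mathfrak g$ be the simple Lie algebra of type $\mathsf D_n$ (Bourbaki labelling: $\alpha_j=e_j-e_{j+1}$ for $j\le n-1$, $\alpha_n=e_{n-1}+e_n$), $\theta$ its highest root, $\delta$ the basic imaginary root and $\alpha_0=\delta-\theta$ the affine simple root. The affine Weyl group $W=\langle s_0,s_1,\dots,s_n\rangle$ is generated by the affine simple reflections, acting on $\bigoplus_{i=0}^n\mathbb Z\alpha_i$. The extended affine Weyl group is $\widetilde W=W_0\ltimes P$, where $W_0=\langle s_1,\dots,s_n\rangle$ and $P$ is the lattice with basis the fundamental weights $\omega_1,\dots,\omega_n$; here $\omega_i\in\widetilde W$ is the translation by $\omega_i$, acting by $\omega_i(\alpha_j)=\alpha_j-\delta_{ij}\delta$ ($1\le j\le n$), $\omega_i(\delta)=\delta$. One has $\widetilde W=\Lambda\ltimes W$, with $\Lambda=\{1,\pi_1,\pi_{n-1},\pi_n\}$ the group of elements permuting $\{\alpha_0,\dots,\alpha_n\}$; $\pi_j$ is the element of $\Lambda$ with $\pi_j(\alpha_0)=\alpha_j$. Explicitly (as diagram automorphisms): $\pi_1$ swaps $0\leftrightarrow1$ and $n-1\leftrightarrow n$ and fixes other nodes; if $n$ is even, $\pi_{n-1}$ swaps $0\leftrightarrow n-1$, $1\leftrightarrow n$ and $\pi_n$ swaps $0\leftrightarrow n$, $1\leftrightarrow n-1$; if $n$ is odd, $\pi_n:0\mapsto n\mapsto1\mapsto n-1\mapsto0$ and $\pi_{n-1}=\pi_n^{-1}$; in all these cases $\pi_{n-1},\pi_n$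 send $j\mapsto n-j$ for $2\le j\le n-2$. The length satisfies $\ell(\lambda w)=\ell(w)$ for $\lambda\in\Lambda$, $w\in W$; an expression $\lambda s_{i_1}\cdots s_{i_r}$ is reduced if $r=\ell(\lambda s_{i_1}\cdots s_{i_r})$. Notation: $[k,l]=s_ks_{k+1}\cdots s_l$ for $1\le k\le l$; $[n-i,n-1]\cdots[1,i]$ denotes $[n-i,n-1][n-i-1,n-2]\cdots[2,i+1][1,i]$; $r_m=s_n[m,n-1][m-1,n-2]$ for $2\le m\le n-2$. In products of $r_m$'s the indices decrease by steps of $2$ down to the last displayed index; such a product is empty if its first index is smaller than its last index. *)

theory Defs
  imports Main
begin

text \<open>
  An element \<open>\<Sum>k\<le>n. v k \<cdot> \<alpha>\<^sub>k\<close> of the affine root lattice is represented by its coordinate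
  function \<open>v :: nat \<Rightarrow> int\<close>. The extended affine Weyl group acts faithfully on this lattice and is
  realised as a group of operators under composition. All operators below extend to arbitrary
  functions \<open>nat \<Rightarrow> int\<close> by fixing the coordinates with index \<open>> n\<close>, and these coordinates
  do not influence the others; hence equality of operators is equality of their restrictions to
  the lattice.
\<close>

type_synonym vec = "nat \<Rightarrow> int"
type_synonym oper = "vec \<Rightarrow> vec"

definition unit_vec :: "nat \<Rightarrow> vec" where
  "unit_vec j = (\<lambda>k. if k = j then 1 else 0)"

text \<open>
  The simple root \<open>\<alpha>\<^sub>j\<close> in the orthonormal basis \<open>e\<^sub>1, \<dots>, e\<^sub>n\<close> (Bourbaki labelling). Node \<open>0\<close> is
  sent to \<open>- \<theta> = - e\<^sub>1 - e\<^sub>2\<close>, the image of \<open>\<alpha>\<^sub>0 = \<delta> - \<theta>\<close> modulo \<open>\<delta>\<close>.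
\<close>

definition finite_part :: "nat \<Rightarrow> nat \<Rightarrow> vec" where
  "finite_part n j = (\<lambda>k.
     if j = 0 then - unit_vec 1 k - unit_vec 2 k
     else if j < n then unit_vec j k - unit_vec (j + 1) k
     else unit_vec (n - 1) k + unit_vec n k)"

text \<open>All roots have squared norm 2, so the Cartan integers are the inner products.\<close>

definition cartan :: "nat \<Rightarrow> nat \<Rightarrow> nat \<Rightarrow> int" where
  "cartan n i j = (\<Sum>k=1..n. finite_part n i k * finite_part n j k)"

abbreviation simple_root :: "nat \<Rightarrow> vec" where
  "simple_root \<equiv> unit_vec"

text \<open>
  \<open>\<delta> = \<alpha>\<^sub>0 + \<theta>\<close> with \<open>\<theta> = \<alpha>\<^sub>1 + 2 (\<alpha>\<^sub>2 + \<dots> + \<alpha>\<^bsub>n-2\<^esub>) + \<alpha>\<^bsub>n-1\<^esub> + \<alpha>\<^sub>n\<close>.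
\<close>

definition delta :: "nat \<Rightarrow> vec" where
  "delta n = (\<lambda>k. if k > n then 0 else if k \<in> {0, 1, n - 1, n} then 1 else 2)"

definition simple_refl :: "nat \<Rightarrow> nat \<Rightarrow> oper" where
  "simple_refl n i v = (\<lambda>k. v k - (\<Sum>j\<le>n. cartan n i j * v j) * simple_root i k)"

text \<open>The product \<open>s\<^bsub>i\<^sub>1\<^esub> \<cdots> s\<^bsub>i\<^sub>r\<^esub>\<close> for the word \<open>[i\<^sub>1, \<dots>, i\<^sub>r]\<close>.\<close>

definition word_prod :: "nat \<Rightarrow> nat list \<Rightarrow> oper" where
  "word_prod n is = foldr (\<lambda>i f. simple_refl n i \<circ> f) is id"

text \<open>Since reflections are involutions, the generated groups consist of the products of words.\<close>

definition finite_weyl :: "nat \<Rightarrow> oper set" where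
  "finite_weyl n = {word_prod n is | is. set is \<subseteq> {1..n}}"

definition affine_weyl :: "nat \<Rightarrow> oper set" where
  "affine_weyl n = {word_prod n is | is. set is \<subseteq> {0..n}}"

text \<open>
  Translation by \<open>\<Sum>i. c i \<cdot> \<omega>\<^sub>i \<in> P\<close>. It is the linear map with \<open>\<alpha>\<^sub>j \<mapsto> \<alpha>\<^sub>j - c j \<cdot> \<delta>\<close> for
  \<open>1 \<le> j \<le> n\<close> and \<open>\<delta> \<mapsto> \<delta>\<close>; the coordinates of \<open>v\<close> in the basis \<open>\<delta>, \<alpha>\<^sub>1, \<dots>, \<alpha>\<^sub>n\<close> are \<open>v 0\<close> and
  \<open>v j - v 0 \<cdot> delta n j\<close>.
\<close>

definition translation :: "nat \<Rightarrow> (nat \<Rightarrow> int) \<Rightarrow> oper" where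
  "translation n c v =
     (\<lambda>k. v k - (\<Sum>j=1..n. c j * (v j - v 0 * delta n j)) * delta n k)"

definition omega :: "nat \<Rightarrow> nat \<Rightarrow> oper" where
  "omega n i = translation n (\<lambda>j. if j = i then 1 else 0)"

lemma omega_simple_root:
  assumes "1 \<le> i" "i \<le> n" "1 \<le> j" "j \<le> n"
  shows "omega n i (simple_root j) =
           (\<lambda>k. simple_root j k - (if i = j then 1 else 0) * delta n k)"
  using assms
  by (auto simp: omega_def translation_def unit_vec_def fun_eq_iff if_distrib[of "\<lambda>x. x * _"]
      cong: if_cong)

lemma omega_delta: "omega n i (delta n) = delta n"
  by (simp add: omega_def translation_def delta_def fun_eq_iff)

definition ext_affine_weyl :: "nat \<Rightarrow> oper set" where
  "ext_affine_weyl n = {w \<circ> translation n c | w c. w \<in> finite_weyl n}"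

definition Lam :: "nat \<Rightarrow> oper set" where
  "Lam n = {x \<in> ext_affine_weyl n. x ` (simple_root ` {0..n}) = simple_root ` {0..n}}"

definition pi_elt :: "nat \<Rightarrow> nat \<Rightarrow> oper" where
  "pi_elt n j = (THE x. x \<in> Lam n \<and> x (simple_root 0) = simple_root j)"

definition cox_length :: "nat \<Rightarrow> oper \<Rightarrow> nat" where
  "cox_length n w = (LEAST r. \<exists>is. set is \<subseteq> {0..n} \<and> length is = r \<and> w = word_prod n is)"

text \<open>\<open>\<ell>(\<lambda> w) = \<ell>(w)\<close> for the decomposition of an element along \<open>\<Lambda> \<ltimes> W\<close>.\<close>

definition ext_length :: "nat \<Rightarrow> oper \<Rightarrow> nat" where
  "ext_length n x =
     cox_length n (THE w. w \<in> affine_weyl n \<and> (\<exists>lam\<in>Lam n. x = lam \<circ> w))"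

text \<open>\<open>\<lambda> s\<^bsub>i\<^sub>1\<^esub> \<cdots> s\<^bsub>i\<^sub>r\<^esub>\<close> is a reduced expression of \<open>x\<close>.\<close>

definition reduced_expression :: "nat \<Rightarrow> oper \<Rightarrow> oper \<Rightarrow> nat list \<Rightarrow> bool" where
  "reduced_expression n x lam is \<longleftrightarrow>
     lam \<in> Lam n \<and> set is \<subseteq> {0..n} \<and> x = lam \<circ> word_prod n is \<and>
     length is = ext_length n (lam \<circ> word_prod n is)"

definition seg :: "nat \<Rightarrow> nat \<Rightarrow> nat list" where
  "seg k l = [k..<Suc l]"

text \<open>\<open>[n-i,n-1][n-i-1,n-2] \<cdots> [1,i]\<close>\<close>

definition segs :: "nat \<Rightarrow> nat \<Rightarrow> nat list" where
  "segs n i = concat (map (\<lambda>j. seg (n - i - j) (n - 1 - j)) [0..<n - i])"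

definition r_word :: "nat \<Rightarrow> nat \<Rightarrow> nat list" where
  "r_word n m = [n] @ seg m (n - 1) @ seg (m - 1) (n - 2)"

text \<open>\<open>r\<^sub>a r\<^bsub>a-2\<^esub> \<cdots> r\<^sub>b\<close>, empty if \<open>a < b\<close>\<close>

definition r_words :: "nat \<Rightarrow> nat \<Rightarrow> nat \<Rightarrow> nat list" where
  "r_words n a b = concat (map (r_word n) (filter (\<lambda>m. even (a - m)) (rev [b..<Suc a])))"

definition word_pow :: "nat list \<Rightarrow> nat \<Rightarrow> nat list" where
  "word_pow w m = concat (replicate m w)"

end

theory Submission
  imports Defs
begin

text \<open>
  Write a vector as \<open>d \<delta> + x\<close> with \<open>x\<close> in the span of \<open>e\<^sub>1, \<dots>, e\<^sub>n\<close>. Then \<open>s\<^sub>1, \<dots>, s\<^sub>n\<close> permute the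
  \<open>x\<^sub>j\<close> up to an even number of signs, \<open>s\<^sub>0\<close> sends \<open>(x\<^sub>1, x\<^sub>2)\<close> to \<open>(- x\<^sub>2, - x\<^sub>1)\<close> and adds \<open>x\<^sub>1 + x\<^sub>2\<close>
  to \<open>d\<close>, and \<open>\<omega>\<^sub>i\<close> subtracts a linear form of \<open>x\<close> from \<open>d\<close>. The block \<open>s\<^sub>0[2,n-1][1,n-2]s\<^sub>n\<close>
  rotates \<open>x\<close> by two places and subtracts the two coordinates that wrap around, the tail
  \<open>[n-i,n-1]\<cdots>[1,i]\<close> rotates by \<open>n - i\<close> places, and each \<open>r\<^sub>m\<close> moves two further coordinates to their
  reversed and negated positions. This determines the action of all six words.

  A root is positive iff its first nonzero entry in \<open>(d, x\<^sub>1, \<dots>, x\<^sub>n)\<close> is positive, and \<open>s\<^sub>i\<close> makes no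
  positive root negative except \<open>\<alpha>\<^sub>i\<close>. Hence a word is at least as long as any set of positive roots
  that it makes negative, and exhibiting as many such roots as there are letters proves reducedness.
  The same fact gives the deletion argument, by which an element of \<open>W\<close> permuting the simple roots is
  trivial; so \<open>\<pi>\<^sub>j\<close> and the decomposition along \<open>\<Lambda> \<ltimes> W\<close> are unique.
\<close>

section \<open>Orthonormal coordinates\<close>

text \<open>Entry \<open>0\<close> holds the coefficient \<open>d\<close> of \<open>\<delta>\<close>, the entries \<open>1, \<dots>, n\<close> hold \<open>x\<close>. The change of
  coordinates \<open>emb\<close> keeps entry \<open>0\<close> because \<open>\<alpha>\<^sub>0 = \<delta> - \<theta>\<close> is the only simple root involving \<open>\<delta>\<close>.\<close>

definition eroot :: "nat \<Rightarrow> nat \<Rightarrow> vec" where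
  "eroot n i = (\<lambda>k. if k = 0 then (if i = 0 then 1 else 0) else if k \<le> n then finite_part n i k else 0)"

definition ip :: "nat \<Rightarrow> vec \<Rightarrow> vec \<Rightarrow> int" where
  "ip n x y = (\<Sum>k=1..n. x k * y k)"

definition erefl :: "nat \<Rightarrow> nat \<Rightarrow> oper" where
  "erefl n i y = (\<lambda>k. y k - ip n (eroot n i) y * eroot n i k)"

definition eword :: "nat \<Rightarrow> nat list \<Rightarrow> oper" where
  "eword n is = foldr (\<lambda>i f. erefl n i \<circ> f) is id"

definition emb :: "nat \<Rightarrow> vec \<Rightarrow> vec" where
  "emb n v = (\<lambda>k. if k = 0 then v 0 else if k \<le> n then \<Sum>j\<le>n. v j * finite_part n j k else v k)"

lemma word_prod_Nil [simp]: "word_prod n [] = id"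
  and word_prod_Cons [simp]: "word_prod n (i # is) v = simple_refl n i (word_prod n is v)"
  by (simp_all add: word_prod_def)

lemma word_prod_append [simp]: "word_prod n (u @ w) v = word_prod n u (word_prod n w v)"
  by (induction u) auto

lemma eword_Nil [simp]: "eword n [] y = y"
  and eword_Cons [simp]: "eword n (i # is) y = erefl n i (eword n is y)"
  by (simp_all add: eword_def)

lemma eword_append [simp]: "eword n (u @ w) y = eword n u (eword n w y)"
  by (induction u) auto

lemma emb_0 [simp]: "emb n v 0 = v 0"
  by (simp add: emb_def)

lemma emb_beyond: "n < k \<Longrightarrow> emb n v k = v k"
  by (simp add: emb_def)

lemma emb_simple_root: "j \<le> n \<Longrightarrow> emb n (simple_root j) = eroot n j"
  by (auto simp: emb_def eroot_def unit_vec_def fun_eq_iff if_distrib[of "\<lambda>x. x * _"] cong: if_cong)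

text \<open>Cartan integers are inner products, so exchanging the two sums turns the coefficient in
  \<open>simple_refl\<close> into a single inner product. \<open>ip\<close> runs over the entries 1
  to n and so ignores the \<delta>-coefficient, also for node 0.\<close>

lemma cartan_sum: "(\<Sum>j\<le>n. cartan n i j * v j) = ip n (eroot n i) (emb n v)"
proof -
  have "(\<Sum>j\<le>n. cartan n i j * v j) =
      (\<Sum>j\<le>n. \<Sum>k=1..n. finite_part n i k * (v j * finite_part n j k))"
    by (simp add: cartan_def sum_distrib_left sum_distrib_right mult_ac)
  also have "\<dots> = (\<Sum>k=1..n. \<Sum>j\<le>n. finite_part n i k * (v j * finite_part n j k))"
    by (rule sum.swap)
  also have "\<dots> = (\<Sum>k=1..n. finite_part n i k * (\<Sum>j\<le>n. v j * finite_part n j k))"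
    by (simp add: sum_distrib_left)
  also have "\<dots> = ip n (eroot n i) (emb n v)"
    unfolding ip_def by (intro sum.cong) (auto simp: eroot_def emb_def)
  finally show ?thesis .
qed

lemma emb_diff: "emb n (\<lambda>k. v k - a * w k) = (\<lambda>k. emb n v k - a * emb n w k)"
  by (auto simp: emb_def fun_eq_iff sum_distrib_left sum_subtractf algebra_simps)

lemma emb_refl:
  assumes "i \<le> n"
  shows "emb n (simple_refl n i v) = erefl n i (emb n v)"
  unfolding simple_refl_def cartan_sum erefl_def emb_diff using assms by (simp add: emb_simple_root)

lemma emb_word: "set is \<subseteq> {0..n} \<Longrightarrow> emb n (word_prod n is v) = eword n is (emb n v)"
  by (induction "is") (auto simp: emb_refl)

section \<open>Inverting the change of coordinates\<close>

lemma emb_explicit: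
  assumes "4 \<le> n" "1 \<le> k" "k \<le> n"
  shows "emb n v k = (if k < n then v k else 0) - (if k \<ge> 2 then v (k - 1) else 0)
    - (if k \<le> 2 then v 0 else 0) + (if n - 1 \<le> k then v n else 0)"
proof -
  \<comment> \<open>Nodes 0 and n are the ones whose roots are not of the form e_j - e_{j+1}; among
    the others only j = k and j = k-1 contribute.\<close>
  have split: "{..n} = insert 0 (insert n {1..<n})" using assms by auto
  have "(\<Sum>j\<le>n. v j * finite_part n j k) = v 0 * finite_part n 0 k + v n * finite_part n n k
      + (\<Sum>j\<in>{1..<n}. v j * finite_part n j k)"
    unfolding split using assms by simp
  also have "(\<Sum>j\<in>{1..<n}. v j * finite_part n j k) =
      (\<Sum>j\<in>{1..<n}. (if j = k then v j else 0) - (if j = k - 1 then v j else 0))"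
    using assms by (intro sum.cong) (auto simp: finite_part_def unit_vec_def)
  also have "\<dots> = (if k < n then v k else 0) - (if k \<ge> 2 then v (k - 1) else 0)"
    using assms by (auto simp: sum_subtractf)
  finally show ?thesis using assms
    by (auto simp: emb_def finite_part_def unit_vec_def)
qed

text \<open>This is the linear form of \<omega>_i for i <= n-2. The differences telescope to
  \<open>v i\<close>, and node 0 contributes -1 at e_1 and again at e_2, which adds up to the
  coefficient \<open>delta n i\<close> of \<delta>.\<close>

lemma partial_sum:
  assumes "4 \<le> n" "1 \<le> i" "i \<le> n - 2"
  shows "(\<Sum>k=1..i. emb n v k) = v i - v 0 * delta n i"
  using assms(2,3)
proof (induction i rule: nat_induct_at_least)
  case base
  then show ?case using assms(1) by (auto simp: emb_explicit delta_def)
next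
  case (Suc i)
  then show ?case using assms(1) by (auto simp: emb_explicit delta_def)
qed

lemma emb_penultimate:
  assumes "4 \<le> n"
  shows "emb n v (n - 1) = v (n - 1) - v (n - 2) + v n"
proof -
  have "n - 1 - 1 = n - 2" by simp
  then show ?thesis using assms by (simp add: emb_explicit del: diff_diff_left)
qed

lemma sum_below:
  assumes "4 \<le> n"
  shows "(\<Sum>k=1..n - 1. emb n v k) = v (n - 1) + v n - 2 * v 0"
proof -
  have "{1..n - 1} = insert (n - 1) {1..n - 2}" using assms by auto
  then have "(\<Sum>k=1..n - 1. emb n v k) = emb n v (n - 1) + (\<Sum>k=1..n - 2. emb n v k)"
    using assms by (simp del: One_nat_def) (subst sum.insert, auto)
  also have "(\<Sum>k=1..n - 2. emb n v k) = v (n - 2) - 2 * v 0"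
    using assms by (subst partial_sum) (auto simp: delta_def)
  also have "emb n v (n - 1) = v (n - 1) - v (n - 2) + v n"
    using assms by (rule emb_penultimate)
  finally show ?thesis by simp
qed

lemma emb_last: "4 \<le> n \<Longrightarrow> emb n v n = v n - v (n - 1)"
  by (simp add: emb_explicit)

text \<open>Entry 0 is kept, partial sums then determine the coefficients up to n-2, and the last
  two follow from their sum (\<open>sum_below\<close>) and difference
  (\<open>emb_last\<close>).\<close>

lemma emb_inject:
  assumes "4 \<le> n" "emb n v = emb n w"
  shows "v = w"
proof
  fix k
  have *: "emb n v j = emb n w j" for j using assms(2) by simp
  have 0: "v 0 = w 0" using *[of 0] by simp
  have "v (n - 1) + v n = w (n - 1) + w n"
    using sum_below[OF assms(1), of v] sum_below[OF assms(1), of w] * 0 by simp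
  moreover have "v n - v (n - 1) = w n - w (n - 1)"
    using *[of n] assms(1) by (simp add: emb_last)
  ultimately have 1: "v n = w n" "v (n - 1) = w (n - 1)" by linarith+
  consider "k = 0" | "1 \<le> k \<and> k \<le> n - 2" | "k = n - 1" | "k = n" | "k > n" by linarith
  then show "v k = w k"
  proof cases
    case 2
    then show ?thesis using partial_sum[OF assms(1), of k v] partial_sum[OF assms(1), of k w] * 0
      by simp
  next
    case 5
    then show ?thesis using *[of k] by (simp add: emb_beyond)
  qed (use 0 1 in auto)
qed

text \<open>The image of \<open>emb\<close> is cut out by a parity condition, which doubling avoids.\<close>

lemma emb_double:
  assumes "4 \<le> n"
  shows "\<exists>v. emb n v = (\<lambda>k. 2 * y k)"
proof -
  \<comment> \<open>Twice the coefficients of y: partial sums up to n-2, and at n-1 and n the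
    half-sums belonging to the spin weights, whose denominators the factor 2 clears. The
    \<open>y 0\<close> terms compensate for \<alpha>_0 = \<delta> - \<theta>.\<close>
  define v where "v = (\<lambda>k. if k = 0 \<or> n < k then 2 * y k
    else if k \<le> n - 2 then 2 * (delta n k * y 0 + (\<Sum>j=1..k. y j))
    else if k = n - 1 then 2 * y 0 + (\<Sum>j=1..n - 1. y j) - y n
    else 2 * y 0 + (\<Sum>j=1..n - 1. y j) + y n)"
  have S: "(\<Sum>j=1..n - 1. y j) = (\<Sum>j=1..n - 2. y j) + y (n - 1)"
  proof -
    have "{1..n - 1} = insert (n - 1) {1..n - 2}" using assms by auto
    then show ?thesis using assms by (simp del: One_nat_def) (subst sum.insert, auto)
  qed
  have v0: "v 0 = 2 * y 0" and vn: "v n = 2 * y 0 + (\<Sum>j=1..n - 1. y j) + y n"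
    and vn1: "v (n - 1) = 2 * y 0 + (\<Sum>j=1..n - 1. y j) - y n"
    and vlow: "1 \<le> k \<Longrightarrow> k \<le> n - 2 \<Longrightarrow> v k = 2 * (delta n k * y 0 + (\<Sum>j=1..k. y j))" for k
    using assms by (auto simp: v_def)
  have "emb n v k = 2 * y k" for k
  proof -
    consider "k = 0" | "k > n" | "k = 1" | "2 \<le> k \<and> k \<le> n - 2" | "k = n - 1" | "k = n" by linarith
    then show ?thesis
    proof cases
      case 1 then show ?thesis using v0 by simp
    next
      case 2 then show ?thesis by (simp add: emb_beyond v_def)
    next
      case 3 then show ?thesis using assms v0 vlow[of 1] by (auto simp: emb_explicit delta_def)
    next
      case 4
      then have "{1..k} = insert k {1..k - 1}" by auto
      then have "(\<Sum>j=1..k. y j) = (\<Sum>j=1..k - 1. y j) + y k"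
        using 4 by (simp del: One_nat_def) (subst sum.insert, auto)
      moreover have "delta n k = 2" "delta n (k - 1) = (if k = 2 then 1 else 2)"
        using 4 assms by (auto simp: delta_def)
      moreover have "emb n v k = v k - v (k - 1) - (if k = 2 then v 0 else 0)"
        using 4 assms by (auto simp: emb_explicit)
      moreover have "v k = 2 * (delta n k * y 0 + (\<Sum>j=1..k. y j))"
        "v (k - 1) = 2 * (delta n (k - 1) * y 0 + (\<Sum>j=1..k - 1. y j))"
        using 4 by (intro vlow; linarith)+
      ultimately show ?thesis using v0 by (simp add: algebra_simps split: if_splits)
    next
      case 5
      have "delta n (n - 2) = 2" using assms by (auto simp: delta_def)
      then have "v (n - 2) = 4 * y 0 + 2 * (\<Sum>j=1..n - 2. y j)" using assms vlow[of "n - 2"] by simp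
      then show ?thesis unfolding 5 emb_penultimate[OF assms] vn vn1 S by simp
    next
      case 6
      then show ?thesis using assms vn vn1 by (simp add: emb_last)
    qed
  qed
  then show ?thesis by blast
qed

section \<open>Simple reflections as isometries in orthonormal coordinates\<close>

lemma ip_sub: "ip n x (\<lambda>k. y k - a * z k) = ip n x y - a * ip n x z"
  by (simp add: ip_def sum_subtractf sum_distrib_left algebra_simps)

lemma ip_commute: "ip n x y = ip n y x"
  by (simp add: ip_def mult.commute)

lemma ip_eroot:
  assumes "4 \<le> n" "i \<le> n"
  shows "ip n (eroot n i) y = (if i = 0 then - y 1 - y 2 else if i < n then y i - y (i + 1)
    else y (n - 1) + y n)"
proof -
  \<comment> \<open>Apart from its \<delta>-coefficient every simple root is a e_p + b e_q; with
    these parameters one computation serves all three shapes.\<close>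
  define p where "p = (if i = 0 then 1 else if i < n then i else n - 1)"
  define q where "q = (if i = 0 then 2 else if i < n then i + 1 else n)"
  define a :: int where "a = (if i = 0 then -1 else 1)"
  define b :: int where "b = (if i = 0 then -1 else if i < n then -1 else 1)"
  have "ip n (eroot n i) y = (\<Sum>k=1..n. (if k = p then a * y k else 0) + (if k = q then b * y k else 0))"
    unfolding ip_def using assms
    by (intro sum.cong) (auto simp: eroot_def finite_part_def unit_vec_def p_def q_def a_def b_def)
  also have "\<dots> = a * y p + b * y q"
    using assms by (auto simp: sum.distrib p_def q_def)
  finally show ?thesis by (auto simp: p_def q_def a_def b_def)
qed

lemma erefl_0:
  assumes "4 \<le> n"
  shows "erefl n 0 y = y(0 := y 0 + y 1 + y 2, 1 := - y 2, 2 := - y 1)"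
  unfolding erefl_def ip_eroot[OF assms(1) le0]
  using assms by (auto simp: fun_eq_iff eroot_def finite_part_def unit_vec_def)

lemma erefl_mid:
  assumes "4 \<le> n" "1 \<le> i" "i < n"
  shows "erefl n i y = y(i := y (i + 1), i + 1 := y i)"
  unfolding erefl_def ip_eroot[OF assms(1) less_imp_le[OF assms(3)]]
  using assms by (auto simp: fun_eq_iff eroot_def finite_part_def unit_vec_def)

lemma erefl_n:
  assumes "4 \<le> n"
  shows "erefl n n y = y(n - 1 := - y n, n := - y (n - 1))"
  unfolding erefl_def ip_eroot[OF assms(1) le_refl]
  using assms by (auto simp: fun_eq_iff eroot_def finite_part_def unit_vec_def)

lemma ip_eroot_self:
  assumes "4 \<le> n" "i \<le> n"
  shows "ip n (eroot n i) (eroot n i) = 2"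
  unfolding ip_eroot[OF assms] using assms by (auto simp: eroot_def finite_part_def unit_vec_def)

lemma erefl_involution:
  assumes "4 \<le> n" "i \<le> n"
  shows "erefl n i (erefl n i y) = y"
  unfolding erefl_def using assms by (auto simp: ip_sub ip_eroot_self)

lemma erefl_sub: "erefl n i (\<lambda>k. x k - a * y k) = (\<lambda>k. erefl n i x k - a * erefl n i y k)"
  by (auto simp: erefl_def ip_sub algebra_simps)

lemma ip_erefl:
  assumes "4 \<le> n" "i \<le> n"
  shows "ip n (erefl n i x) (erefl n i y) = ip n x y"
proof -
  have "ip n (erefl n i x) (erefl n i y) = ip n x (erefl n i y) - ip n (eroot n i) x * ip n (eroot n i) (erefl n i y)"
    unfolding erefl_def[of n i x] ip_commute[of n _ "erefl n i y"] ip_sub by (simp add: ip_commute)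
  moreover have "ip n x (erefl n i y) = ip n x y - ip n (eroot n i) y * ip n (eroot n i) x"
    unfolding erefl_def ip_sub by (simp add: ip_commute)
  moreover have "ip n (eroot n i) (erefl n i y) = - ip n (eroot n i) y"
    unfolding erefl_def ip_sub using ip_eroot_self[OF assms] by simp
  ultimately show ?thesis by (simp add: algebra_simps)
qed

lemma eword_sub: "eword n is (\<lambda>k. x k - a * y k) = (\<lambda>k. eword n is x k - a * eword n is y k)"
  by (induction "is") (auto simp: erefl_sub)

lemma ip_eword:
  "4 \<le> n \<Longrightarrow> set is \<subseteq> {0..n} \<Longrightarrow> ip n (eword n is x) (eword n is y) = ip n x y"
  by (induction "is") (auto simp: ip_erefl)

lemma eword_rev:
  "4 \<le> n \<Longrightarrow> set is \<subseteq> {0..n} \<Longrightarrow> eword n (rev is) (eword n is y) = y"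
  by (induction "is" arbitrary: y) (auto simp: erefl_involution)

lemma word_prod_rev:
  assumes "4 \<le> n" "set is \<subseteq> {0..n}"
  shows "word_prod n (rev is) (word_prod n is v) = v"
  by (rule emb_inject[OF assms(1)]) (use assms in \<open>simp add: emb_word eword_rev\<close>)

lemma word_prod_rev':
  assumes "4 \<le> n" "set is \<subseteq> {0..n}"
  shows "word_prod n is (word_prod n (rev is) v) = v"
  using word_prod_rev[of n "rev is" v] assms by simp

lemma eword_double: "eword n is (\<lambda>k. 2 * y k) = (\<lambda>k. 2 * eword n is y k)"
proof -
  have "eword n is (\<lambda>k. y k - (- 1) * y k) = (\<lambda>k. eword n is y k - (- 1) * eword n is y k)"
    by (rule eword_sub)
  then show ?thesis by (simp flip: mult_2)
qed

text \<open>Length is defined through \<open>word_prod\<close> while inversions are counted through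
  \<open>eword\<close>; this transfers between them. \<open>emb\<close> is injective but not
  surjective, so the forward direction tests on doubled vectors and halves the result.\<close>

lemma word_prod_eq_iff:
  assumes "4 \<le> n" "set u \<subseteq> {0..n}" "set w \<subseteq> {0..n}"
  shows "word_prod n u = word_prod n w \<longleftrightarrow> eword n u = eword n w"
proof
  assume *: "word_prod n u = word_prod n w"
  show "eword n u = eword n w"
  proof
    fix y
    obtain v where v: "emb n v = (\<lambda>k. 2 * y k)" using emb_double[OF assms(1)] by blast
    have "(\<lambda>k. 2 * eword n u y k) = (\<lambda>k. 2 * eword n w y k)"
      using arg_cong[where f = "\<lambda>f. emb n (f v)", OF *] assms v
      by (simp add: emb_word eword_double)
    then show "eword n u y = eword n w y" by (simp add: fun_eq_iff)
  qed
next
  assume *: "eword n u = eword n w"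
  show "word_prod n u = word_prod n w"
  proof
    fix v
    show "word_prod n u v = word_prod n w v"
      by (rule emb_inject[OF assms(1)]) (use assms * in \<open>simp add: emb_word\<close>)
  qed
qed

section \<open>Positive roots and length\<close>

definition lexpos :: "vec \<Rightarrow> bool" where
  "lexpos y \<longleftrightarrow> (\<exists>k. 0 < y k \<and> (\<forall>j<k. y j = 0))"

definition lexneg :: "vec \<Rightarrow> bool" where
  "lexneg y \<longleftrightarrow> (\<exists>k. y k < 0 \<and> (\<forall>j<k. y j = 0))"

text \<open>Integral vectors of norm 2, that is, \<open>d \<delta> \<plusminus> e\<^sub>a \<plusminus> e\<^sub>b\<close> with \<open>a \<noteq> b\<close>: the real roots.\<close>

definition is_root :: "nat \<Rightarrow> vec \<Rightarrow> bool" where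
  "is_root n y \<longleftrightarrow> ip n y y = 2 \<and> (\<forall>k>n. y k = 0)"

lemma lexposI: "0 < y k \<Longrightarrow> (\<And>j. j < k \<Longrightarrow> y j = 0) \<Longrightarrow> lexpos y"
  by (auto simp: lexpos_def)

lemma lexnegI: "y k < 0 \<Longrightarrow> (\<And>j. j < k \<Longrightarrow> y j = 0) \<Longrightarrow> lexneg y"
  by (auto simp: lexneg_def)

lemma not_lexpos_lexneg:
  assumes "lexpos y"
  shows "\<not> lexneg y"
proof
  assume "lexneg y"
  with assms obtain k l where "0 < y k" "\<forall>j<k. y j = 0" "y l < 0" "\<forall>j<l. y j = 0"
    by (auto simp: lexpos_def lexneg_def)
  then show False by (cases k l rule: linorder_cases) auto
qed

lemma lexpos_or_lexneg:
  assumes "y k \<noteq> 0"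
  shows "lexpos y \<or> lexneg y"
proof -
  define m where "m = (LEAST k. y k \<noteq> 0)"
  have "y m \<noteq> 0" unfolding m_def using assms by (rule LeastI)
  moreover have "\<forall>j<m. y j = 0" unfolding m_def using not_less_Least by blast
  ultimately show ?thesis unfolding lexpos_def lexneg_def by (cases "y m" "0 :: int" rule: linorder_cases) auto
qed

lemma is_root_pos_or_neg:
  assumes "is_root n y"
  shows "lexpos y \<or> lexneg y"
proof -
  have "\<exists>k. y k \<noteq> 0"
  proof (rule ccontr)
    assume "\<not> ?thesis"
    then have "ip n y y = 0" by (simp add: ip_def)
    then show False using assms by (simp add: is_root_def)
  qed
  then show ?thesis using lexpos_or_lexneg by blast
qed

text \<open>The squares of two nonzero integers already add up to at least 2, so norm 2 leaves
  nothing for the other entries.\<close>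

lemma is_root_pair:
  assumes "is_root n y" "1 \<le> a" "a \<le> n" "1 \<le> b" "b \<le> n" "a \<noteq> b" "y a \<noteq> 0" "y b \<noteq> 0"
  shows "\<bar>y a\<bar> = 1" "\<bar>y b\<bar> = 1" "\<And>k. k \<noteq> a \<Longrightarrow> k \<noteq> b \<Longrightarrow> k \<noteq> 0 \<Longrightarrow> y k = 0"
proof -
  let ?R = "{1..n} - {a, b}"
  have "{1..n} = insert a (insert b ?R)" using assms by auto
  then have "ip n y y = (\<Sum>k\<in>insert a (insert b ?R). y k * y k)" by (simp add: ip_def)
  also have "\<dots> = y a * y a + (y b * y b + (\<Sum>k\<in>?R. y k * y k))" using assms(6) by simp
  finally have s: "y a * y a + (y b * y b + (\<Sum>k\<in>?R. y k * y k)) = 2"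
    using assms(1) by (simp add: is_root_def)
  have nn: "0 \<le> (\<Sum>k\<in>?R. y k * y k)" by (rule sum_nonneg) simp
  have sq: "1 \<le> x * x" if "x \<noteq> 0" for x :: int
  proof -
    have "0 < x * x" using that by (auto simp: zero_less_mult_iff)
    then show ?thesis by linarith
  qed
  note sq = sq[OF assms(7)] sq[OF assms(8)]
  have "y a * y a = 1" "y b * y b = 1" and z: "(\<Sum>k\<in>?R. y k * y k) = 0"
    using s nn sq by linarith+
  then show "\<bar>y a\<bar> = 1" "\<bar>y b\<bar> = 1" by (auto simp: zmult_eq_1_iff)
  from z have "\<forall>k\<in>?R. y k * y k = 0" by (subst (asm) sum_nonneg_eq_0_iff) auto
  then show "y k = 0" if "k \<noteq> a" "k \<noteq> b" "k \<noteq> 0" for k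
    using that assms(1) by (cases "k \<le> n") (auto simp: is_root_def)
qed

lemma is_root_bound:
  assumes "is_root n y" "1 \<le> a" "a \<le> n"
  shows "\<bar>y a\<bar> \<le> 1"
proof -
  have "y a * y a \<le> ip n y y"
    unfolding ip_def using assms by (intro member_le_sum) auto
  then have "y a * y a \<le> 2" using assms by (simp add: is_root_def)
  show ?thesis
  proof (rule ccontr)
    assume "\<not> ?thesis"
    then have "2 * 2 \<le> \<bar>y a\<bar> * \<bar>y a\<bar>" by (intro mult_mono) auto
    then show False using \<open>y a * y a \<le> 2\<close> by simp
  qed
qed

lemma is_root_eroot: "4 \<le> n \<Longrightarrow> i \<le> n \<Longrightarrow> is_root n (eroot n i)"
  unfolding is_root_def by (intro conjI ip_eroot_self) (auto simp: eroot_def)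

lemma is_root_erefl:
  assumes "4 \<le> n" "i \<le> n" "is_root n y"
  shows "is_root n (erefl n i y)"
  unfolding is_root_def
proof (intro conjI allI impI)
  show "ip n (erefl n i y) (erefl n i y) = 2"
    using assms(3) ip_erefl[OF assms(1,2), of y y] by (simp add: is_root_def)
  show "erefl n i y k = 0" if "n < k" for k
    using assms(3) that by (simp add: is_root_def erefl_def) (simp add: eroot_def)
qed

lemma is_root_eword: "4 \<le> n \<Longrightarrow> set is \<subseteq> {0..n} \<Longrightarrow> is_root n y \<Longrightarrow> is_root n (eword n is y)"
  by (induction "is") (auto simp: is_root_erefl)

section \<open>Simple reflections and the sign of a root\<close>

lemma lexpos_eroot:
  assumes "4 \<le> n" "i \<le> n"
  shows "lexpos (eroot n i)"
proof (cases "i < n")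
  case True
  then show ?thesis
    by (intro lexposI[of _ i]) (auto simp: eroot_def finite_part_def unit_vec_def)
next
  case False
  then show ?thesis using assms
    by (intro lexposI[of _ "n - 1"]) (auto simp: eroot_def finite_part_def unit_vec_def)
qed

lemma erefl_self:
  assumes "4 \<le> n" "i \<le> n"
  shows "erefl n i (eroot n i) = (\<lambda>k. - eroot n i k)"
  using ip_eroot_self[OF assms] by (simp add: erefl_def)

text \<open>2 is not a square, so a single entry cannot carry the whole norm.\<close>

lemma is_root_two_supports:
  assumes "is_root n y"
  shows "\<exists>j\<in>{1..n}. j \<noteq> p \<and> y j \<noteq> 0"
proof (rule ccontr)
  assume "\<not> ?thesis"
  then have "ip n y y = (\<Sum>k=1..n. if k = p then y p * y p else 0)"
    unfolding ip_def by (intro sum.cong) auto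
  then have p: "y p * y p = 2" using assms by (auto simp: is_root_def split: if_splits)
  have "\<bar>y p\<bar> < 2"
  proof (rule ccontr)
    assume "\<not> ?thesis"
    then have "2 * 2 \<le> \<bar>y p\<bar> * \<bar>y p\<bar>" by (intro mult_mono) auto
    then show False using p by simp
  qed
  then have "y p = - 1 \<or> y p = 0 \<or> y p = 1" by linarith
  then show False using p by auto
qed

text \<open>Treats all reflections except \<open>s_0\<close> together: s = 1 is the swap of entries
  i and i+1, s = -1 with i+1 = n is \<open>s_n\<close>. Unless the first nonzero entry of y is one
  of these two, it survives in place; this forces the signs of the pair, and norm 2 fixes the
  root.\<close>

lemma lexpos_swap_cases:
  assumes y: "is_root n y" "lexpos y" and i: "1 \<le> i" "i < n"
    and neg: "lexneg (y(i := s * y (i + 1), i + 1 := s * y i))" (is "lexneg ?z")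
    and s: "s = 1 \<or> s = - 1 \<and> i + 1 = n"
  shows "y = (\<lambda>k. if k = i then 1 else if k = i + 1 then - s else 0)"
proof -
  have npos: "\<not> lexpos ?z" using neg not_lexpos_lexneg by blast
  obtain k where k: "0 < y k" "\<And>j. j < k \<Longrightarrow> y j = 0" using y by (auto simp: lexpos_def)
  have "k = i \<or> k = i + 1"
  proof (rule ccontr)
    assume "\<not> ?thesis"
    then have "lexpos ?z" using k by (intro lexposI[of _ k]) auto
    then show False using npos by blast
  qed
  then have low: "y j = 0" if "j < i" for j using k(2)[of j] that by auto
  have "0 < y i \<and> s * y (i + 1) < 0"
    using s
  proof
    assume s: "s = 1"
    have "y i > 0"
      using \<open>k = i \<or> k = i + 1\<close>
    proof
      assume "k = i + 1"
      then have "lexpos ?z" using k s low by (intro lexposI[of _ i]) auto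
      then show ?thesis using npos by blast
    qed (use k in simp)
    moreover have "y (i + 1) < 0"
    proof (rule ccontr)
      assume "\<not> ?thesis"
      then have "lexpos ?z" using \<open>y i > 0\<close> s low
        by (intro lexposI[of _ "if y (i + 1) = 0 then i + 1 else i"])
          (auto simp: less_Suc_eq split: if_splits)
      then show False using npos by blast
    qed
    ultimately show ?thesis using s by simp
  next
    assume s: "s = - 1 \<and> i + 1 = n"
    \<comment> \<open>Everything below i vanishes and nothing follows i+1 = n, so the two nonzero
      entries that a root must have are these two.\<close>
    have nz: "y i \<noteq> 0" "y (i + 1) \<noteq> 0"
      using is_root_two_supports[OF y(1), of i] is_root_two_supports[OF y(1), of "i + 1"] low s
      by (metis One_nat_def atLeastAtMost_iff linorder_neqE_nat Suc_eq_plus1 not_less_eq not_le)+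
    then have "k = i" using \<open>k = i \<or> k = i + 1\<close> k(2)[of i] by auto
    moreover have "y (i + 1) > 0"
    proof (rule ccontr)
      assume "\<not> ?thesis"
      then have "lexpos ?z" using nz s low by (intro lexposI[of _ i]) auto
      then show False using npos by blast
    qed
    ultimately show ?thesis using s k by simp
  qed
  then have *: "y i > 0" "s * y (i + 1) < 0" by auto
  then have "y i \<noteq> 0" "y (i + 1) \<noteq> 0" by auto
  note pair = is_root_pair[OF y(1), of i "i + 1", OF i(1) _ _ _ _ this]
  have 1: "\<bar>y i\<bar> = 1" "\<bar>y (i + 1)\<bar> = 1"
    and z: "\<And>k. k \<noteq> i \<Longrightarrow> k \<noteq> i + 1 \<Longrightarrow> k \<noteq> 0 \<Longrightarrow> y k = 0"
    by (rule pair; use i in simp)+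
  have "y i = 1" "y (i + 1) = - s" using 1 * s by auto
  then show ?thesis using z low[of 0] i by (auto simp: fun_eq_iff)
qed

lemma lexpos_head:
  assumes "lexpos y"
  shows "y 0 \<ge> 0" "y 0 = 0 \<Longrightarrow> y 1 \<ge> 0" "y 0 = 0 \<Longrightarrow> y 1 = 0 \<Longrightarrow> y 2 \<ge> 0"
proof -
  obtain k where k: "0 < y k" "\<And>j. j < k \<Longrightarrow> y j = 0" using assms by (auto simp: lexpos_def)
  consider "k = 0" | "k = 1" | "k = 2" | "k > 2" by linarith
  note c = this
  show "y 0 \<ge> 0" using k(1) k(2)[of 0] by (cases "k = 0") auto
  show "y 0 = 0 \<Longrightarrow> y 1 \<ge> 0" using c k(1) k(2)[of 1] by cases auto
  show "y 0 = 0 \<Longrightarrow> y 1 = 0 \<Longrightarrow> y 2 \<ge> 0" using c k(1) k(2)[of 2] by cases auto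
qed

lemma positive_root_made_negative:
  assumes "4 \<le> n" "i \<le> n" "is_root n y" "lexpos y" "lexneg (erefl n i y)"
  shows "y = eroot n i"
proof -
  consider "i = 0" | "1 \<le> i" "i < n" | "i = n" using assms(2) by linarith
  then show ?thesis
  proof cases
    case 1
    let ?z = "erefl n 0 y"
    have z: "?z 0 = y 0 + y 1 + y 2" "?z 1 = - y 2" "?z 2 = - y 1"
      using assms(1) by (simp_all add: erefl_0)
    \<comment> \<open>For \<open>s_0\<close> the entries 0, 1, 2 decide: positivity of y and of -z,
      with y_1 and y_2 in {-1, 0, 1} and not both zero, leaves only y_0 = 1, y_1 = y_2 = -1.\<close>
    have "lexpos (\<lambda>k. - ?z k)" using assms(5) 1 by (simp add: lexpos_def lexneg_def)
    note h = lexpos_head[OF this, unfolded z] lexpos_head[OF assms(4)]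
    have b: "\<bar>y 1\<bar> \<le> 1" "\<bar>y 2\<bar> \<le> 1" using is_root_bound[OF assms(3)] assms(1) by auto
    have "\<not> (y 1 = 0 \<and> y 2 = 0)"
    proof
      assume "y 1 = 0 \<and> y 2 = 0"
      then have "?z = y" using assms(1) by (auto simp: erefl_0)
      then show False using assms(4,5) 1 not_lexpos_lexneg by simp
    qed
    with h b have "y 1 = - 1 \<and> y 2 = - 1 \<and> y 0 = 1" by (smt (verit))
    then have y: "y 1 = - 1" "y 2 = - 1" "y 0 = 1" by auto
    then have "y k = 0" if "k \<noteq> 0" "k \<noteq> 1" "k \<noteq> 2" for k
      using is_root_pair(3)[OF assms(3), of 1 2 k] that assms(1) by simp
    then show ?thesis using y 1 assms(1)
      by (auto simp: fun_eq_iff eroot_def finite_part_def unit_vec_def)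
  next
    case 2
    then have "y = (\<lambda>k. if k = i then 1 else if k = i + 1 then - 1 else 0)"
      using assms by (intro lexpos_swap_cases) (auto simp: erefl_mid)
    then show ?thesis using 2 by (auto simp: fun_eq_iff eroot_def finite_part_def unit_vec_def)
  next
    case 3
    have "lexneg (y(n - 1 := - y n, n := - y (n - 1)))" using assms 3 by (simp add: erefl_n)
    then have "y = (\<lambda>k. if k = n - 1 then 1 else if k = n - 1 + 1 then - (- 1) else 0)"
      using assms by (intro lexpos_swap_cases) auto
    then show ?thesis using 3 assms(1)
      by (auto simp: fun_eq_iff eroot_def finite_part_def unit_vec_def)
  qed
qed

text \<open>Induction on the word: letter i, applied last, can turn negative only the root whose
  image under the other letters is \<alpha>_i, so each letter accounts for at most one element of
  J.\<close>

lemma card_inversions_le: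
  assumes "4 \<le> n" "set is \<subseteq> {0..n}" "finite J"
    and "\<And>y. y \<in> J \<Longrightarrow> is_root n y \<and> lexpos y \<and> lexneg (eword n is y)"
  shows "card J \<le> length is"
  using assms(2-4)
proof (induction "is" arbitrary: J)
  case Nil
  then have "J = {}" using not_lexpos_lexneg by fastforce
  then show ?case by simp
next
  case (Cons i u)
  let ?N = "{y \<in> J. lexneg (eword n u y)}"
  have i: "i \<le> n" and u: "set u \<subseteq> {0..n}" using Cons.prems by auto
  have "card ?N \<le> length u" using Cons.prems by (intro Cons.IH) auto
  moreover have "J - ?N \<subseteq> {eword n (rev u) (eroot n i)}"
  proof
    fix y assume y: "y \<in> J - ?N"
    then have r: "is_root n (eword n u y)" using Cons.prems(3) assms(1) u by (auto intro: is_root_eword)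
    then have "lexpos (eword n u y)" using y is_root_pos_or_neg by blast
    moreover have "lexneg (erefl n i (eword n u y))" using y Cons.prems(3)[of y] by simp
    ultimately have "eword n u y = eroot n i"
      using positive_root_made_negative[OF assms(1) i r] by blast
    then show "y \<in> {eword n (rev u) (eroot n i)}" using eword_rev[OF assms(1) u, of y] by simp
  qed
  then have "card (J - ?N) \<le> 1" using card_mono[of "{eword n (rev u) (eroot n i)}"] by simp
  moreover have "card J = card ?N + card (J - ?N)"
    using Cons.prems(2) by (subst card_Diff_subset) (auto simp: card_mono)
  ultimately show ?case by simp
qed

text \<open>The deletion argument: if \<open>u\<close> makes \<open>\<alpha>\<^sub>j\<close> negative, then some letter \<open>i\<close> of \<open>u\<close> changes the
  sign of the image of \<open>\<alpha>\<^sub>j\<close>, which must then be \<open>\<alpha>\<^sub>i\<close>; this letter cancels against \<open>s\<^sub>j\<close> in \<open>u s\<^sub>j\<close>.\<close>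

lemma delete_two_letters:
  assumes "4 \<le> n" "set u \<subseteq> {0..n}" "j \<le> n" "lexneg (eword n u (eroot n j))"
  shows "\<exists>w. set w \<subseteq> set u \<and> length w < length u \<and> (\<forall>y. eword n w y = eword n u (erefl n j y))"
  using assms(2,4)
proof (induction u)
  case Nil
  then show ?case using lexpos_eroot[OF assms(1,3)] not_lexpos_lexneg by auto
next
  case (Cons i u)
  have i: "i \<le> n" and u: "set u \<subseteq> {0..n}" using Cons.prems by auto
  let ?b = "eword n u (eroot n j)"
  have r: "is_root n ?b" using assms u by (intro is_root_eword is_root_eroot) auto
  show ?case
  proof (cases "lexneg ?b")
    case True
    then obtain w where w: "set w \<subseteq> set u" "length w < length u"
      "\<forall>y. eword n w y = eword n u (erefl n j y)" using Cons.IH u by blast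
    then show ?thesis by (intro exI[of _ "i # w"]) auto
  next
    case False
    then have "lexpos ?b" using is_root_pos_or_neg[OF r] by blast
    then have b: "?b = eroot n i"
      using positive_root_made_negative[OF assms(1) i r] Cons.prems by simp
    \<comment> \<open>Since u is an isometry, conjugating \<open>s_j\<close> by it gives the
      reflection in the image of \<alpha>_j, which is \<open>s_i\<close>.\<close>
    have "eword n u (erefl n j y) = erefl n i (eword n u y)" for y
    proof -
      have "ip n (eroot n i) (eword n u y) = ip n (eroot n j) y"
        using ip_eword[OF assms(1) u] b by metis
      then show ?thesis by (simp add: erefl_def[of n j] eword_sub b erefl_def[of n i])
    qed
    then have "eword n (i # u) (erefl n j y) = eword n u y" for y
      using erefl_involution[OF assms(1) i] by simp
    then show ?thesis by (intro exI[of _ u]) auto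
  qed
qed

text \<open>Strong induction on the length. If j is the last letter and v the rest, u sends
  \<alpha>_j to the negative of its image under v; as the former is positive, v makes \<alpha>_j
  negative, and deletion yields a shorter word with the action of u.\<close>

lemma eword_id_if_positive:
  assumes "4 \<le> n" "set u \<subseteq> {0..n}" "\<And>j. j \<le> n \<Longrightarrow> lexpos (eword n u (eroot n j))"
  shows "eword n u y = y"
  using assms(2,3)
proof (induction "length u" arbitrary: u rule: less_induct)
  case less
  show ?case
  proof (cases u rule: rev_cases)
    case (snoc v j)
    have j: "j \<le> n" and v: "set v \<subseteq> {0..n}" using less.prems snoc by auto
    \<comment> \<open>Both instances of \<open>eword_sub\<close> serve linearity: the second shows
      that 0 goes to 0, the first then moves v past the negation.\<close>
    have "eword n u (eroot n j) = (\<lambda>k. - eword n v (eroot n j) k)"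
      using eword_sub[of n v "\<lambda>k. 0" 1 "eroot n j"] eword_sub[of n v "eroot n j" 1 "eroot n j"]
      by (simp add: snoc erefl_self[OF assms(1) j])
    then have "lexneg (eword n v (eroot n j))"
      using less.prems(2)[OF j] by (simp add: lexpos_def lexneg_def)
    then obtain w where w: "set w \<subseteq> set v" "length w < length v"
      "\<forall>y. eword n w y = eword n v (erefl n j y)"
      using delete_two_letters[OF assms(1) v j] by blast
    then have eq: "eword n w = eword n u" by (auto simp: snoc fun_eq_iff)
    have "eword n w y = y"
    proof (rule less.hyps)
      show "length w < length u" "set w \<subseteq> {0..n}" using w v snoc by auto
      show "lexpos (eword n w (eroot n j))" if "j \<le> n" for j
        unfolding eq using that by (rule less.prems(2))
    qed
    then show ?thesis unfolding eq .
  qed simp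
qed

section \<open>Uniqueness of the diagram automorphisms\<close>

lemma simple_refl_ip: "simple_refl n i v = (\<lambda>k. v k - ip n (eroot n i) (emb n v) * unit_vec i k)"
  unfolding simple_refl_def cartan_sum ..

lemma emb_delta:
  assumes "4 \<le> n" "1 \<le> k" "k \<le> n"
  shows "emb n (delta n) k = 0"
proof -
  consider "k = 1" | "k = 2" | "2 < k \<and> k \<le> n - 2" | "k = n - 1" | "k = n" using assms by linarith
  then show ?thesis
    by cases (use assms in \<open>auto simp: emb_explicit emb_penultimate[unfolded One_nat_def] delta_def\<close>)
qed

lemma ip_emb_delta: "4 \<le> n \<Longrightarrow> ip n x (emb n (delta n)) = 0"
  by (simp add: ip_def emb_delta del: One_nat_def)

lemma simple_refl_sub_delta:
  assumes "4 \<le> n"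
  shows "simple_refl n i (\<lambda>k. v k - a * delta n k) = (\<lambda>k. simple_refl n i v k - a * delta n k)"
  using assms by (simp add: simple_refl_ip emb_diff ip_sub ip_emb_delta algebra_simps)

lemma word_prod_sub_delta:
  "4 \<le> n \<Longrightarrow> word_prod n u (\<lambda>k. v k - a * delta n k) = (\<lambda>k. word_prod n u v k - a * delta n k)"
  by (induction u) (auto simp: simple_refl_sub_delta)

lemma word_prod_0: "set u \<subseteq> {1..n} \<Longrightarrow> word_prod n u v 0 = v 0"
  by (induction u) (auto simp: simple_refl_def unit_vec_def)

text \<open>The value of the weight with coefficients c on the finite part of v, which is expanded
  in \<alpha>_1, ..., \<alpha>_n once \<open>v 0\<close> copies of \<delta> are removed.\<close>

definition pairing :: "nat \<Rightarrow> (nat \<Rightarrow> int) \<Rightarrow> vec \<Rightarrow> int" where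
  "pairing n c v = (\<Sum>j=1..n. c j * (v j - v 0 * delta n j))"

lemma translation_pairing: "translation n c v = (\<lambda>k. v k - pairing n c v * delta n k)"
  by (simp add: translation_def pairing_def)

lemma delta_0 [simp]: "delta n 0 = 1"
  by (simp add: delta_def)

lemma pairing_sub_delta: "pairing n c (\<lambda>k. v k - a * delta n k) = pairing n c v"
  by (simp add: pairing_def algebra_simps)

lemma translation_add: "translation n c (translation n c' v) = translation n (\<lambda>j. c j + c' j) v"
proof -
  have "pairing n (\<lambda>j. c j + c' j) v = pairing n c v + pairing n c' v"
    by (simp add: pairing_def distrib_right sum.distrib)
  then show ?thesis unfolding translation_pairing pairing_sub_delta by (simp add: algebra_simps)
qed

lemma translation_zero:
  assumes "\<And>j. 1 \<le> j \<Longrightarrow> j \<le> n \<Longrightarrow> c j = 0"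
  shows "translation n c v = v"
  using assms by (simp add: translation_def)

text \<open>Conjugation by \<open>s_i\<close> reflects the weight of a translation. The new
  coefficients arise because \<alpha>_i is the sum of the \<open>cartan n i k\<close> multiples of
  \<omega>_k.\<close>

lemma translation_refl:
  assumes "4 \<le> n" "1 \<le> i" "i \<le> n"
  shows "translation n c (simple_refl n i v) = simple_refl n i (translation n (\<lambda>k. c k - c i * cartan n i k) v)"
proof -
  let ?b = "ip n (eroot n i) (emb n v)"
  have "pairing n c (simple_refl n i v) =
      (\<Sum>j=1..n. c j * (v j - v 0 * delta n j) - (if j = i then c j * ?b else 0))"
    unfolding pairing_def using assms(2)
    by (intro sum.cong) (auto simp: simple_refl_ip unit_vec_def algebra_simps)
  then have 1: "pairing n c (simple_refl n i v) = pairing n c v - c i * ?b"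
    using assms by (simp add: sum_subtractf pairing_def)
  \<comment> \<open>Index 0 can be added to the sum because \<open>v 0 - v 0 * delta n 0\<close> is
    0.\<close>
  have "{..n} = insert 0 {1..n}" by auto
  then have "(\<Sum>j=1..n. cartan n i j * (v j - v 0 * delta n j)) =
      (\<Sum>j\<le>n. cartan n i j * (v j - v 0 * delta n j))"
    by simp
  also have "\<dots> = (\<Sum>j\<le>n. cartan n i j * v j) - v 0 * (\<Sum>j\<le>n. cartan n i j * delta n j)"
    by (simp add: sum_subtractf sum_distrib_left algebra_simps)
  also have "\<dots> = ?b" using ip_emb_delta[OF assms(1)] by (simp add: cartan_sum)
  finally have "pairing n (\<lambda>k. c k - c i * cartan n i k) v = pairing n c v - c i * ?b"
    by (simp add: pairing_def left_diff_distrib sum_subtractf mult.assoc flip: sum_distrib_left)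
  then show ?thesis
    unfolding translation_pairing simple_refl_sub_delta[OF assms(1)] 1 by simp
qed

text \<open>Iterating \<open>translation_refl\<close> normalises products to a finite word followed
  on the right by a translation; c' is c acted on by the inverse word.\<close>

lemma translation_word:
  assumes "4 \<le> n" "set u \<subseteq> {1..n}"
  shows "\<exists>c'. \<forall>v. translation n c (word_prod n u v) = word_prod n u (translation n c' v)"
  using assms(2)
proof (induction u arbitrary: c)
  case (Cons i u)
  then obtain c' where
    "\<forall>v. translation n (\<lambda>k. c k - c i * cartan n i k) (word_prod n u v) = word_prod n u (translation n c' v)"
    by auto blast
  moreover have "1 \<le> i" "i \<le> n" using Cons.prems by auto
  ultimately show ?case
    by (intro exI[of _ c']) (simp add: translation_refl[OF assms(1)])
qed auto

section \<open>The extended group and the subgroup \<Lambda>\<close>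

lemma ext_affine_weylE:
  assumes "x \<in> ext_affine_weyl n"
  obtains u c where "set u \<subseteq> {1..n}" "\<And>v. x v = word_prod n u (translation n c v)"
  using assms by (auto simp: ext_affine_weyl_def finite_weyl_def)

lemma ext_affine_weylI:
  assumes "set u \<subseteq> {1..n}" "\<And>v. x v = word_prod n u (translation n c v)"
  shows "x \<in> ext_affine_weyl n"
  using assms by (auto simp: ext_affine_weyl_def finite_weyl_def fun_eq_iff)

lemma inj_ext:
  assumes "4 \<le> n" "x \<in> ext_affine_weyl n"
  shows "inj x"
proof -
  obtain u c where u: "set u \<subseteq> {1..n}" and x: "\<And>v. x v = word_prod n u (translation n c v)"
    using assms(2) by (rule ext_affine_weylE) blast
  have "translation n (\<lambda>j. - c j) (word_prod n (rev u) (x v)) = v" for v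
    using u by (simp add: x subset_iff word_prod_rev[OF assms(1)] translation_add translation_zero)
  then show ?thesis
    by (intro inj_on_inverseI[where g = "\<lambda>w. translation n (\<lambda>j. - c j) (word_prod n (rev u) w)"])
qed

lemma Lam_inj: "4 \<le> n \<Longrightarrow> x \<in> Lam n \<Longrightarrow> inj x"
  by (simp add: Lam_def inj_ext)

text \<open>Here z plays the role of y^{-1} x, given only through its composition with y. As y is
  injective and permutes the simple roots, it can be cancelled.\<close>

lemma Lam_quotient_permutes:
  assumes n: "4 \<le> n" and "x \<in> Lam n" "y \<in> Lam n" and z: "\<And>v. y (z v) = x v" and "j \<le> n"
  shows "\<exists>m\<le>n. z (simple_root j) = simple_root m"
proof -
  have "y (z (simple_root j)) \<in> simple_root ` {0..n}"
    unfolding z using assms(2,5) by (auto simp: Lam_def)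
  then have "y (z (simple_root j)) \<in> y ` simple_root ` {0..n}" using assms(3) by (simp add: Lam_def)
  then have "z (simple_root j) \<in> simple_root ` {0..n}"
    using Lam_inj[OF n assms(3)] by (simp add: inj_image_mem_iff)
  then show ?thesis by auto
qed

lemma word_prod_permuting_simple_roots:
  assumes "4 \<le> n" "set u \<subseteq> {0..n}" "\<And>j. j \<le> n \<Longrightarrow> \<exists>m\<le>n. word_prod n u (simple_root j) = simple_root m"
  shows "word_prod n u v = v"
proof (rule emb_inject[OF assms(1)])
  have pos: "lexpos (eword n u (eroot n j))" if j: "j \<le> n" for j
  proof -
    from assms(3)[OF j] obtain m where m: "m \<le> n" "word_prod n u (simple_root j) = simple_root m"
      by (elim exE conjE)
    have "eword n u (eroot n j) = emb n (word_prod n u (simple_root j))"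
      by (simp only: emb_word[OF assms(2)] emb_simple_root[OF j])
    also have "\<dots> = eroot n m" unfolding m(2) by (rule emb_simple_root[OF m(1)])
    finally show ?thesis using lexpos_eroot[OF assms(1) m(1)] by (simp only:)
  qed
  show "emb n (word_prod n u v) = emb n v"
    unfolding emb_word[OF assms(2)] by (rule eword_id_if_positive[OF assms(1,2) pos])
qed

text \<open>From x w = y w' it follows that y^{-1} x = w' w^{-1} is a word sending simple roots to
  simple roots, hence trivial.\<close>

lemma Lam_affine_unique:
  assumes n: "4 \<le> n" and "x \<in> Lam n" "y \<in> Lam n" "w \<in> affine_weyl n" "w' \<in> affine_weyl n"
    and eq: "x \<circ> w = y \<circ> w'"
  shows "w = w'"
proof -
  obtain u u' where u: "set u \<subseteq> {0..n}" "w = word_prod n u"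
    and u': "set u' \<subseteq> {0..n}" "w' = word_prod n u'"
    using assms(4,5) by (auto simp: affine_weyl_def)
  let ?z = "u' @ rev u"
  have z: "y (word_prod n ?z v) = x v" for v
    using fun_cong[OF eq, of "word_prod n (rev u) v"] u u' n by (simp add: word_prod_rev')
  have "word_prod n ?z v = v" for v
    using n Lam_quotient_permutes[OF n assms(2,3) z] u(1) u'(1)
    by (intro word_prod_permuting_simple_roots) auto
  from this[of "word_prod n u _"] show ?thesis using u u' n by (auto simp: fun_eq_iff word_prod_rev)
qed

text \<open>Write y^{-1} x as a finite word times the translation by e. It permutes the simple roots
  and fixes \<alpha>_0, which forces e = 0; the remaining word is then trivial.\<close>

lemma Lam_unique:
  assumes n: "4 \<le> n" and x: "x \<in> Lam n" and y: "y \<in> Lam n" and eq: "x (simple_root 0) = y (simple_root 0)"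
  shows "x = y"
proof -
  obtain u c where u: "set u \<subseteq> {1..n}" and xu: "\<And>v. x v = word_prod n u (translation n c v)"
    using x by (auto simp: Lam_def elim: ext_affine_weylE)
  obtain u' c' where u': "set u' \<subseteq> {1..n}" and yu: "\<And>v. y v = word_prod n u' (translation n c' v)"
    using y by (auto simp: Lam_def elim: ext_affine_weylE)
  let ?w = "rev u' @ u"
  have w: "set ?w \<subseteq> {1..n}" "set u' \<subseteq> {0..n}" "set ?w \<subseteq> {0..n}" using u u' by auto
  obtain d where d: "\<And>v. translation n (\<lambda>j. - c' j) (word_prod n ?w v) = word_prod n ?w (translation n d v)"
    using translation_word[OF n w(1)] by blast
  \<comment> \<open>Moving the translation by -c' past the finite word turns it into d, which then
    merges with c.\<close>
  define e where "e = (\<lambda>j. d j + c j)"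
  have z: "y (word_prod n ?w (translation n e v)) = x v" for v
  proof -
    have "y (word_prod n ?w (translation n e v)) =
        word_prod n u' (translation n c' (translation n (\<lambda>j. - c' j) (word_prod n ?w (translation n c v))))"
      by (simp only: yu d e_def translation_add[symmetric])
    also have "\<dots> = word_prod n u' (word_prod n (rev u') (word_prod n u (translation n c v)))"
      by (simp add: translation_add translation_zero)
    finally show ?thesis using w(2) n by (simp add: word_prod_rev' xu)
  qed
  have perm: "\<exists>m\<le>n. word_prod n ?w (translation n e (simple_root j)) = simple_root m" if "j \<le> n" for j
    using Lam_quotient_permutes[OF n x y z that] .
  have inj: "inj (\<lambda>v. word_prod n ?w (translation n e v))"
    using w(1) by (intro inj_ext[OF n] ext_affine_weylI[of ?w _ _ e]) auto
  have fix0: "word_prod n ?w (translation n e (simple_root 0)) = simple_root 0"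
    using z[of "simple_root 0"] eq Lam_inj[OF n y] by (simp add: inj_eq)
  have "e j = 0" if j: "1 \<le> j" "j \<le> n" for j
  proof -
    obtain m where m: "word_prod n ?w (translation n e (simple_root j)) = simple_root m"
      using perm j by blast
    have "m \<noteq> 0"
    proof
      assume "m = 0"
      then have "(simple_root j :: vec) = simple_root 0" using injD[OF inj, of "simple_root j" "simple_root 0"]
        unfolding m fix0 by simp
      then show False using j by (auto simp: unit_vec_def fun_eq_iff split: if_splits)
    qed
    \<comment> \<open>The finite word keeps entry 0 and the image is a simple root other than
      \<alpha>_0, so the translation cannot shift \<alpha>_j by a multiple of \<delta>; that
      multiple is e_j.\<close>
    have "translation n e (simple_root j) 0 = 0"
      using fun_cong[OF m, of 0] word_prod_0[OF w(1)] \<open>m \<noteq> 0\<close> by (simp add: unit_vec_def)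
    moreover have "pairing n e (simple_root j) = (\<Sum>k=1..n. if k = j then e j else 0)"
      unfolding pairing_def using j by (intro sum.cong) (auto simp: unit_vec_def)
    ultimately show ?thesis using j by (simp add: translation_pairing unit_vec_def)
  qed
  then have e: "translation n e v = v" for v by (rule translation_zero)
  have w_id: "word_prod n ?w v = v" for v
    by (rule word_prod_permuting_simple_roots[OF n w(3)]) (rule perm[unfolded e])
  show "x = y"
  proof
    show "x v = y v" for v using z[of v, symmetric] unfolding e w_id .
  qed
qed

lemma pi_elt_eqI:
  assumes "4 \<le> n" "x \<in> Lam n" "x (simple_root 0) = simple_root j"
  shows "pi_elt n j = x"
  unfolding pi_elt_def
proof (rule the_equality)
  show "x \<in> Lam n \<and> x (simple_root 0) = simple_root j" using assms by simp
  show "y = x" if "y \<in> Lam n \<and> y (simple_root 0) = simple_root j" for y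
    using that assms(3) by (intro Lam_unique[OF assms(1) _ assms(2)]) simp_all
qed

lemma ext_length_eq:
  assumes "4 \<le> n" "x \<in> Lam n" "set u \<subseteq> {0..n}"
  shows "ext_length n (x \<circ> word_prod n u) = cox_length n (word_prod n u)"
proof -
  have u: "word_prod n u \<in> affine_weyl n" using assms(3) by (auto simp: affine_weyl_def)
  have "(THE w. w \<in> affine_weyl n \<and> (\<exists>lam\<in>Lam n. x \<circ> word_prod n u = lam \<circ> w)) = word_prod n u"
    using u assms(2) Lam_affine_unique[OF assms(1,2) _ u] by (intro the_equality) blast+
  then show ?thesis by (simp add: ext_length_def)
qed

text \<open>Every word for the same operator has the same \<open>eword\<close>, hence makes all of J
  negative and has at least \<open>card J\<close> letters by
  \<open>card_inversions_le\<close>.\<close>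

lemma reduced_expressionI:
  assumes n: "4 \<le> n" and lam: "lam \<in> Lam n" and u: "set u \<subseteq> {0..n}" and x: "x = lam \<circ> word_prod n u"
    and J: "finite J" "length u \<le> card J"
    "\<And>y. y \<in> J \<Longrightarrow> is_root n y \<and> lexpos y \<and> lexneg (eword n u y)"
  shows "reduced_expression n x lam u"
proof -
  have "cox_length n (word_prod n u) = length u"
    unfolding cox_length_def
  proof (rule Least_equality)
    show "\<exists>w. set w \<subseteq> {0..n} \<and> length w = length u \<and> word_prod n u = word_prod n w"
      using u by blast
  next
    fix r assume "\<exists>w. set w \<subseteq> {0..n} \<and> length w = r \<and> word_prod n u = word_prod n w"
    then obtain w where w: "set w \<subseteq> {0..n}" "length w = r" "word_prod n u = word_prod n w" by blast
    then have "eword n u = eword n w" using word_prod_eq_iff[OF n u] by simp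
    then have "card J \<le> length w" using J by (intro card_inversions_le[OF n w(1)]) auto
    then show "length u \<le> r" using J w by simp
  qed
  then show ?thesis
    unfolding reduced_expression_def x using lam u by (simp add: ext_length_eq[OF n])
qed

section \<open>Action of the words\<close>

lemma eword_upt:
  assumes "4 \<le> n" "1 \<le> k" "k \<le> m" "m \<le> n"
  shows "eword n [k..<m] y = (\<lambda>j. if j = k then y m else if k < j \<and> j \<le> m then y (j - 1) else y j)"
  using assms(3,4)
proof (induction m arbitrary: y rule: nat_induct_at_least)
  case base
  then show ?case by auto
next
  case (Suc m)
  then have "eword n [k..<Suc m] y = eword n [k..<m] (y(m := y (m + 1), m + 1 := y m))"
    using assms(1,2) by (simp add: erefl_mid)
  also have "\<dots> = (\<lambda>j. if j = k then y (Suc m) else if k < j \<and> j \<le> Suc m then y (j - 1) else y j)"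
    using Suc.hyps Suc.prems by (subst Suc.IH) (auto simp: fun_eq_iff)
  finally show ?case .
qed

lemma eword_seg:
  assumes "4 \<le> n" "1 \<le> k" "k \<le> Suc l" "Suc l \<le> n"
  shows "eword n (seg k l) y =
    (\<lambda>j. if j = k then y (Suc l) else if k < j \<and> j \<le> Suc l then y (j - 1) else y j)"
  unfolding seg_def using assms by (rule eword_upt)

text \<open>\<open>segs n i\<close> with p in place of n - i, so that induction on p can peel off
  the leading segment while i stays fixed.\<close>

definition seg_chain :: "nat \<Rightarrow> nat \<Rightarrow> nat list" where
  "seg_chain i p = concat (map (\<lambda>j. seg (p - j) (p + i - 1 - j)) [0..<p])"

lemma segs_chain: "i \<le> n \<Longrightarrow> segs n i = seg_chain i (n - i)"
  by (simp add: segs_def seg_chain_def)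

lemma seg_chain_0 [simp]: "seg_chain i 0 = []"
  by (simp add: seg_chain_def)

lemma seg_chain_Suc: "seg_chain i (Suc p) = seg (Suc p) (p + i) @ seg_chain i p"
proof -
  have "[0..<Suc p] = 0 # map Suc [0..<p]" by (simp add: map_Suc_upt upt_conv_Cons del: upt_Suc)
  then show ?thesis by (simp add: seg_chain_def comp_def del: upt_Suc)
qed

text \<open>Each new segment cycles entry p+i+1 to position p+1 and pushes the block holding the
  original first i entries one place up.\<close>

lemma eword_seg_chain:
  assumes "4 \<le> n" "1 \<le> i" "p + i \<le> n"
  shows "eword n (seg_chain i p) y =
    (\<lambda>j. if 1 \<le> j \<and> j \<le> p then y (i + j) else if p < j \<and> j \<le> p + i then y (j - p) else y j)"
  using assms(3)
proof (induction p)
  case 0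
  then show ?case by auto
next
  case (Suc p)
  then have z: "eword n (seg_chain i p) y =
    (\<lambda>j. if 1 \<le> j \<and> j \<le> p then y (i + j) else if p < j \<and> j \<le> p + i then y (j - p) else y j)"
    by simp
  show ?case
    unfolding seg_chain_Suc eword_append z using Suc.prems assms(1,2)
    by (subst eword_seg) (auto simp: fun_eq_iff intro!: arg_cong[of _ _ y])
qed

lemma length_seg_chain: "length (seg_chain i p) = p * i"
  by (induction p) (auto simp: seg_chain_Suc seg_def)

lemma set_seg_chain: "p + i \<le> Suc n \<Longrightarrow> set (seg_chain i p) \<subseteq> {1..n}"
  by (induction p) (auto simp: seg_chain_Suc seg_def)

lemma eword_segs:
  assumes "4 \<le> n" "1 \<le> i" "i \<le> n"
  shows "eword n (segs n i) y =
    (\<lambda>j. if 1 \<le> j \<and> j \<le> n - i then y (i + j) else if n - i < j \<and> j \<le> n then y (j - (n - i)) else y j)"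
  using assms by (auto simp: segs_chain eword_seg_chain fun_eq_iff)

lemma eword_signed_rot:
  assumes "4 \<le> n"
  shows "eword n (seg 1 (n - 2) @ [n]) y =
    (\<lambda>j. if j = 1 then - y n else if 1 < j \<and> j < n then y (j - 1) else if j = n then - y (n - 1) else y j)"
proof -
  have "Suc (n - 2) = n - 1" using assms by simp
  then show ?thesis using assms by (auto simp: eword_seg erefl_n fun_eq_iff)
qed

definition rot_word :: "nat \<Rightarrow> nat list" where
  "rot_word n = [0] @ seg 2 (n - 1) @ seg 1 (n - 2) @ [n]"

lemma eword_rot_word:
  assumes "4 \<le> n"
  shows "eword n (rot_word n) y = (\<lambda>j. if j = 0 then y 0 - y (n - 1) - y n else if j = 1 then y (n - 1)
    else if j = 2 then y n else if j \<le> n then y (j - 2) else y j)"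
proof -
  have e: "Suc (n - 1) = n" using assms by simp
  have "eword n (rot_word n) y = erefl n 0 (eword n (seg 2 (n - 1)) (eword n (seg 1 (n - 2) @ [n]) y))"
    by (simp add: rot_word_def)
  also have "eword n (seg 2 (n - 1)) (eword n (seg 1 (n - 2) @ [n]) y) =
      (\<lambda>j. if j = 1 then - y n else if j = 2 then - y (n - 1)
        else if 2 < j \<and> j \<le> n then y (j - 2) else y j)"
    unfolding eword_signed_rot[OF assms]
    using assms by (subst eword_seg) (auto simp: fun_eq_iff e numeral_2_eq_2)
  finally show ?thesis using assms by (auto simp: erefl_0 fun_eq_iff)
qed

lemma word_pow_0 [simp]: "word_pow w 0 = []"
  and word_pow_Suc [simp]: "word_pow w (Suc m) = w @ word_pow w m"
  by (simp_all add: word_pow_def)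

text \<open>While 2m <= n no entry wraps around twice, so entry 0 loses each of the last 2m entries
  exactly once.\<close>

lemma eword_rot_pow:
  assumes "4 \<le> n" "2 * m \<le> n"
  shows "eword n (word_pow (rot_word n) m) y = (\<lambda>j. if j = 0 then y 0 - (\<Sum>k=n - 2 * m + 1..n. y k)
    else if j \<le> 2 * m then y (n - 2 * m + j) else if j \<le> n then y (j - 2 * m) else y j)"
  using assms(2)
proof (induction m)
  case 0
  then show ?case by (auto simp: fun_eq_iff)
next
  case (Suc m)
  let ?z = "eword n (word_pow (rot_word n) m) y"
  have z: "?z = (\<lambda>j. if j = 0 then y 0 - (\<Sum>k=n - 2 * m + 1..n. y k)
    else if j \<le> 2 * m then y (n - 2 * m + j) else if j \<le> n then y (j - 2 * m) else y j)"
    using Suc by simp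
  have "{n - 2 * Suc m + 1..n} = insert (n - 2 * m - 1) (insert (n - 2 * m) {n - 2 * m + 1..n})"
    using Suc.prems by auto
  then have s: "(\<Sum>k=n - 2 * Suc m + 1..n. y k) =
      y (n - 2 * m - 1) + (y (n - 2 * m) + (\<Sum>k=n - 2 * m + 1..n. y k))"
    using Suc.prems by (simp del: One_nat_def Suc_eq_plus1) (subst sum.insert; auto)+
  have ends: "?z (n - 1) = y (n - 2 * m - 1)" "?z n = y (n - 2 * m)"
    "?z 0 = y 0 - (\<Sum>k=n - 2 * m + 1..n. y k)"
    unfolding z using assms(1) Suc.prems by (auto simp: diff_right_commute)
  have inner: "?z (j - 2) = (if j \<le> 2 * Suc m then y (n - 2 * Suc m + j) else y (j - 2 * Suc m))"
    if "2 < j" "j \<le> n" for j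
    unfolding z using that Suc.prems by (auto intro!: arg_cong[of _ _ y])
  have outer: "?z j = y j" if "n < j" for j
    unfolding z using that Suc.prems by simp
  have "eword n (word_pow (rot_word n) (Suc m)) y = eword n (rot_word n) ?z" by simp
  also have "\<dots> = (\<lambda>j. if j = 0 then ?z 0 - ?z (n - 1) - ?z n else if j = 1 then ?z (n - 1)
    else if j = 2 then ?z n else if j \<le> n then ?z (j - 2) else ?z j)"
    by (rule eword_rot_word[OF assms(1)])
  finally have *: "eword n (word_pow (rot_word n) (Suc m)) y = \<dots>" .
  show ?case unfolding * s
  proof (rule ext)
    fix j
    consider "j = 0" | "j = 1" | "j = 2" | "2 < j \<and> j \<le> n" | "n < j" by linarith
    then show "(if j = 0 then ?z 0 - ?z (n - 1) - ?z n else if j = 1 then ?z (n - 1)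
        else if j = 2 then ?z n else if j \<le> n then ?z (j - 2) else ?z j) =
      (if j = 0 then y 0 - (y (n - 2 * m - 1) + (y (n - 2 * m) + (\<Sum>k=n - 2 * m + 1..n. y k)))
        else if j \<le> 2 * Suc m then y (n - 2 * Suc m + j) else if j \<le> n then y (j - 2 * Suc m) else y j)"
    proof cases
      case 1
      then show ?thesis unfolding ends by simp
    next
      case 2
      have "n - 2 * m - 1 = n - 2 * Suc m + 1" using Suc.prems by simp
      then show ?thesis using 2 unfolding ends by simp
    next
      case 3
      have "n - 2 * m = n - 2 * Suc m + 2" using Suc.prems by simp
      then show ?thesis using 3 by (simp add: ends)
    qed (use Suc.prems in \<open>auto simp: inner outer\<close>)
  qed
qed

text \<open>Identifies what the blocks will wrap around: after the tail, the last m entries are the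
  original entries i-m+1, ..., i.\<close>

lemma sum_segs:
  assumes "4 \<le> n" "1 \<le> i" "i \<le> n" "m \<le> i"
  shows "(\<Sum>k=n - m + 1..n. eword n (segs n i) y k) = (\<Sum>k=i - m + 1..i. y k)"
proof -
  have "(\<Sum>k=i - m + 1..i. y k) = (\<Sum>k=i - m + 1..i. eword n (segs n i) y (k + (n - i)))"
    using assms by (intro sum.cong) (auto simp: eword_segs)
  also have "\<dots> = (\<Sum>k=i - m + 1 + (n - i)..i + (n - i). eword n (segs n i) y k)"
    by (rule sum.shift_bounds_cl_nat_ivl[symmetric])
  also have "i - m + 1 + (n - i) = n - m + 1" using assms by simp
  also have "i + (n - i) = n" using assms by simp
  finally show ?thesis by simp
qed

lemma eword_segs_shift:
  assumes "4 \<le> n" "1 \<le> i" "i \<le> n"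
  shows "1 \<le> j \<Longrightarrow> j \<le> i \<Longrightarrow> eword n (segs n i) y (n - i + j) = y j"
    and "i < j \<Longrightarrow> j \<le> n \<Longrightarrow> eword n (segs n i) y (j - i) = y j"
    and "eword n (segs n i) y 0 = y 0"
    and "n < j \<Longrightarrow> eword n (segs n i) y j = y j"
proof -
  show "eword n (segs n i) y (n - i + j) = y j" if "1 \<le> j" "j \<le> i"
  proof -
    have "n - i + j - (n - i) = j" "n - i < n - i + j" "n - i + j \<le> n" "\<not> n - i + j \<le> n - i"
      using that assms(3) by auto
    then show ?thesis unfolding eword_segs[OF assms] by (simp only: if_True if_False simp_thms)
  qed
  show "eword n (segs n i) y (j - i) = y j" if "i < j" "j \<le> n"
  proof -
    have "i + (j - i) = j" "1 \<le> j - i" "j - i \<le> n - i" using that by auto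
    then show ?thesis unfolding eword_segs[OF assms] by (simp only: if_True simp_thms)
  qed
  show "eword n (segs n i) y 0 = y 0" by (simp add: eword_segs[OF assms])
  show "eword n (segs n i) y j = y j" if "n < j"
  proof -
    have "\<not> j \<le> n - i" "\<not> j \<le> n" using that by auto
    then show ?thesis unfolding eword_segs[OF assms] by (simp only: if_False simp_thms)
  qed
qed

text \<open>Tail and blocks together rotate by (n-i) + i = n places, which restores x; the entries
  that wrap around in the blocks are the first i.\<close>

lemma eword_even_case:
  assumes "4 \<le> n" "1 \<le> i" "i \<le> n" "even i"
  shows "eword n (word_pow (rot_word n) (i div 2) @ segs n i) y = y(0 := y 0 - (\<Sum>k=1..i. y k))"
proof -
  define w where "w = eword n (segs n i) y"
  note w = eword_segs_shift[OF assms(1-3), where y = y, folded w_def]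
  have i: "2 * (i div 2) = i" using assms(4) by simp
  have sum: "(\<Sum>k=n - i + 1..n. w k) = (\<Sum>k=1..i. y k)"
    using sum_segs[OF assms(1-3) order_refl, of y] by (simp add: w_def)
  have "eword n (word_pow (rot_word n) (i div 2) @ segs n i) y =
      (\<lambda>j. if j = 0 then w 0 - (\<Sum>k=n - i + 1..n. w k) else if j \<le> i then w (n - i + j)
        else if j \<le> n then w (j - i) else w j)"
    using eword_rot_pow[OF assms(1), of "i div 2" w] assms(3) unfolding i by (simp add: w_def)
  also have "\<dots> = y(0 := y 0 - (\<Sum>k=1..i. y k))"
    unfolding sum using w by (auto simp: fun_eq_iff not_le Suc_le_eq)
  finally show ?thesis .
qed

text \<open>The total rotation is again n, but the signed rotation makes its last place: this leaves
  minus signs at 1 and n, and only the entries 2 to i wrap around in the affine blocks.\<close>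

lemma eword_odd_case:
  assumes "4 \<le> n" "1 \<le> i" "i \<le> n - 2" "odd i"
  shows "eword n ((seg 1 (n - 2) @ [n]) @ word_pow (rot_word n) ((i - 1) div 2) @ segs n i) y =
    y(0 := y 0 - (\<Sum>k=2..i. y k), 1 := - y 1, n := - y n)"
proof -
  define w where "w = eword n (segs n i) y"
  define z where "z = eword n (word_pow (rot_word n) ((i - 1) div 2)) w"
  have i: "2 * ((i - 1) div 2) = i - 1" using assms(4) by simp
  have "i \<le> n" using assms(3) by simp
  note w = eword_segs_shift[OF assms(1,2) \<open>i \<le> n\<close>, where y = y, folded w_def]
  have "i - (i - 1) + 1 = 2" using assms(2) by simp
  then have sum: "(\<Sum>k=n - (i - 1) + 1..n. w k) = (\<Sum>k=2..i. y k)"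
    using sum_segs[OF assms(1,2) \<open>i \<le> n\<close>, of "i - 1" y] by (simp add: w_def del: One_nat_def)
  have z: "z = (\<lambda>j. if j = 0 then y 0 - (\<Sum>k=2..i. y k) else if j \<le> i - 1 then w (n - (i - 1) + j)
      else if j \<le> n then w (j - (i - 1)) else w j)"
    unfolding z_def
    by (rule eword_rot_pow[OF assms(1), of "(i - 1) div 2" w, unfolded i sum w(3)]) (use \<open>i \<le> n\<close> in simp)
  have z0: "z 0 = y 0 - (\<Sum>k=2..i. y k)" by (simp add: z)
  have zmid: "z j = y (j + 1)" if "1 \<le> j" "j < n" for j
  proof (cases "j \<le> i - 1")
    case True
    have "n - (i - 1) + j = n - i + (j + 1)" using assms(2) \<open>i \<le> n\<close> by simp
    then show ?thesis using True that w(1)[of "j + 1"] assms(2) by (simp add: z)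
  next
    case False
    have "j - (i - 1) = j + 1 - i" using assms(2) by simp
    then show ?thesis using False that w(2)[of "j + 1"] by (simp add: z)
  qed
  have zn: "z n = y 1"
  proof -
    have "n - (i - 1) = n - i + 1" "\<not> n \<le> i - 1" using assms(1-3) by auto
    then show ?thesis using w(1)[of 1] assms by (simp add: z)
  qed
  have zout: "z j = y j" if "n < j" for j
  proof -
    have "j \<noteq> 0" "\<not> j \<le> i - 1" "\<not> j \<le> n" using that \<open>i \<le> n\<close> by auto
    then show ?thesis using w(4)[OF that] by (simp add: z)
  qed
  have "eword n ((seg 1 (n - 2) @ [n]) @ word_pow (rot_word n) ((i - 1) div 2) @ segs n i) y =
    (\<lambda>j. if j = 1 then - z n else if 1 < j \<and> j < n then z (j - 1) else if j = n then - z (n - 1) else z j)"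
    unfolding eword_append[of n "seg 1 (n - 2) @ [n]"] eword_signed_rot[OF assms(1)]
      eword_append[of n "word_pow _ _"] w_def z_def ..
  also have "\<dots> = y(0 := y 0 - (\<Sum>k=2..i. y k), 1 := - y 1, n := - y n)"
  proof
    fix j
    consider "j = 0" | "j = 1" | "1 < j \<and> j < n" | "j = n" | "n < j" by linarith
    then show "(if j = 1 then - z n else if 1 < j \<and> j < n then z (j - 1) else if j = n then - z (n - 1) else z j) =
      (y(0 := y 0 - (\<Sum>k=2..i. y k), 1 := - y 1, n := - y n)) j"
    proof cases
      case 3
      then have "1 \<le> j - 1" "j - 1 < n" "j - 1 + 1 = j" by auto
      then have "z (j - 1) = y j" using zmid[of "j - 1"] by simp
      then show ?thesis using 3 by simp
    next
      case 4
      then show ?thesis using zmid[of "n - 1"] assms(1) by simp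
    qed (use assms(1) in \<open>auto simp: z0 zn zout\<close>)
  qed
  finally show ?thesis .
qed

section \<open>The words built from the \<open>r_m\<close>\<close>

lemma r_words_less: "a < b \<Longrightarrow> r_words n a b = []"
  by (simp add: r_words_def)

lemma r_words_step:
  assumes "b \<le> Suc (Suc a)"
  shows "r_words n (Suc (Suc a)) b = r_word n (Suc (Suc a)) @ r_words n a b"
proof (cases "b \<le> Suc a")
  case True
  have "filter (\<lambda>m. even (Suc (Suc a) - m)) (rev [b..<Suc a]) = filter (\<lambda>m. even (a - m)) (rev [b..<Suc a])"
    by (intro filter_cong) (auto simp: Suc_diff_le)
  then show ?thesis using True by (simp add: r_words_def)
next
  case False
  then have "b = Suc (Suc a)" using assms by simp
  then show ?thesis by (simp add: r_words_def)
qed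

text \<open>Read from the right: the two segments carry the last two entries to m-1 and m and push
  those from m-1 on two places up, then \<open>s_n\<close> swaps and negates the new last
  two.\<close>

lemma eword_r_word:
  assumes "4 \<le> n" "2 \<le> m" "m \<le> n - 2"
  shows "eword n (r_word n m) y = (\<lambda>j. if j = m - 1 then y (n - 1) else if j = m then y n
    else if m < j \<and> j \<le> n - 2 then y (j - 2) else if j = n - 1 then - y (n - 2)
    else if j = n then - y (n - 3) else y j)"
proof -
  have e: "Suc (n - 2) = n - 1" "Suc (n - 1) = n" using assms by auto
  define x where "x = eword n (seg (m - 1) (n - 2)) y"
  have x: "x = (\<lambda>j. if j = m - 1 then y (n - 1) else if m - 1 < j \<and> j \<le> n - 1 then y (j - 1) else y j)"
    unfolding x_def by (rule eword_seg[OF assms(1), of _ "n - 2", unfolded e]) (use assms in auto)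
  define z where "z = eword n (seg m (n - 1)) x"
  have z: "z = (\<lambda>j. if j = m then x n else if m < j \<and> j \<le> n then x (j - 1) else x j)"
    unfolding z_def by (rule eword_seg[OF assms(1), of _ "n - 1", unfolded e]) (use assms in auto)
  have "m - 1 \<noteq> m" "n \<noteq> m - 1" "\<not> n \<le> n - 1" "\<not> m < m - 1" using assms by auto
  then have zm1: "z (m - 1) = y (n - 1)" and zm: "z m = y n"
    by (simp_all add: x z)
  have zmid: "z j = y (j - 2)" if "m < j" "j \<le> n" for j
  proof -
    have "\<not> j - 1 = m - 1" "m - 1 < j - 1" "j - 1 \<le> n - 1" "j - 1 - 1 = j - 2" "j \<noteq> m"
      using that assms(2) by auto
    then show ?thesis using that unfolding x z by (simp only: if_True if_False simp_thms)
  qed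
  have zout: "z j = y j" if "j < m - 1 \<or> n < j" for j
  proof -
    have "j \<noteq> m" "\<not> (m < j \<and> j \<le> n)" "j \<noteq> m - 1" "\<not> (m - 1 < j \<and> j \<le> n - 1)"
      using that assms by auto
    then show ?thesis unfolding x z by (simp only: if_False)
  qed
  have "eword n (r_word n m) y = z(n - 1 := - z n, n := - z (n - 1))"
    using assms(1) by (simp add: r_word_def erefl_n x_def z_def)
  also have "\<dots> = (\<lambda>j. if j = m - 1 then y (n - 1) else if j = m then y n
    else if m < j \<and> j \<le> n - 2 then y (j - 2) else if j = n - 1 then - y (n - 2)
    else if j = n then - y (n - 3) else y j)"
  proof
    fix j
    consider "j = m - 1" | "j = m" | "m < j \<and> j \<le> n - 2" | "j = n - 1" | "j = n" | "j < m - 1 \<or> n < j"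
      by linarith
    then show "(z(n - 1 := - z n, n := - z (n - 1))) j = (if j = m - 1 then y (n - 1) else if j = m then y n
      else if m < j \<and> j \<le> n - 2 then y (j - 2) else if j = n - 1 then - y (n - 2)
      else if j = n then - y (n - 3) else y j)"
    proof cases
      case 1
      then show ?thesis using assms zm1 by auto
    next
      case 2
      then show ?thesis using assms zm by auto
    next
      case 3
      then have "j \<noteq> n - 1" "j \<noteq> n" "j \<noteq> m - 1" "j \<noteq> m" "z j = y (j - 2)"
        using zmid[of j] assms by auto
      then show ?thesis using 3 by simp
    next
      case 4
      then have "j \<noteq> m - 1" "j \<noteq> m" "\<not> j \<le> n - 2" "j \<noteq> n" "z n = y (n - 2)"
        using zmid[of n] assms by auto
      then show ?thesis using 4 by simp
    next
      case 5
      have "m < n - 1" "n - 1 - 2 = n - 3" using assms by auto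
      then have "z (n - 1) = y (n - 3)" using zmid[of "n - 1"] by (simp only: diff_le_self)
      moreover have "j \<noteq> m - 1" "j \<noteq> m" "\<not> j \<le> n - 2" "j \<noteq> n - 1" using 5 assms by auto
      ultimately show ?thesis using 5 by simp
    next
      case 6
      then have "j \<noteq> m - 1" "j \<noteq> m" "\<not> (m < j \<and> j \<le> n - 2)" "j \<noteq> n - 1" "j \<noteq> n"
        using assms by auto
      then show ?thesis using zout[OF 6] by auto
    qed
  qed
  finally show ?thesis .
qed

text \<open>Invariant after t factors: entries up to c are untouched, the next 2t are final, the
  last two already carry their signs (hence the trailing \<open>s_n\<close>), and the rest has moved
  up by 2t. The next factor brings the last pair to c+2t+1 and c+2t+2. The uses are c = 0 for
  \<omega>_n and c = 1 for \<omega>_{n-1}.\<close>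

lemma eword_r_words:
  assumes "4 \<le> n" "c + 2 * t \<le> n - 2"
  shows "eword n (r_words n (c + 2 * t) (c + 2) @ [n]) y = (\<lambda>j. if j \<le> c then y j
    else if j \<le> c + 2 * t then - y (n + c + 1 - j) else if j \<le> n - 2 then y (j - 2 * t)
    else if j = n - 1 then - y (n - 2 * t) else if j = n then - y (n - 2 * t - 1) else y j)"
  using assms(2)
proof (induction t)
  case 0
  then show ?case using assms(1) by (auto simp: r_words_less erefl_n fun_eq_iff)
next
  case (Suc t)
  let ?m = "Suc (Suc (c + 2 * t))"
  define z where "z = eword n (r_words n (c + 2 * t) (c + 2) @ [n]) y"
  have m: "c + 2 * Suc t = ?m" "?m \<le> n - 2" "c + 2 * t \<le> n - 2" "2 \<le> ?m" using Suc.prems by auto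
  have z: "z = (\<lambda>j. if j \<le> c then y j
    else if j \<le> c + 2 * t then - y (n + c + 1 - j) else if j \<le> n - 2 then y (j - 2 * t)
    else if j = n - 1 then - y (n - 2 * t) else if j = n then - y (n - 2 * t - 1) else y j)"
    unfolding z_def by (rule Suc.IH[OF m(3)])
  have step: "eword n (r_words n (c + 2 * Suc t) (c + 2) @ [n]) y = eword n (r_word n ?m) z"
    unfolding m(1) z_def by (simp add: r_words_step)
  have z_end: "z (n - 1) = - y (n - 2 * t)" "z n = - y (n - 2 * t - 1)"
    using m assms(1) by (auto simp: z)
  have z_low: "z j = (if j \<le> c then y j else - y (n + c + 1 - j))" if "j \<le> c + 2 * t" for j
    using that by (simp add: z)
  have z_mid: "z j = y (j - 2 * t)" if "c + 2 * t < j" "j \<le> n - 2" for j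
    using that by (simp add: z)
  have z_out: "z j = y j" if "n < j" for j
  proof -
    have "\<not> j \<le> c" "\<not> j \<le> c + 2 * t" "\<not> j \<le> n - 2" "j \<noteq> n - 1" "j \<noteq> n" using that m by auto
    then show ?thesis by (simp add: z)
  qed
  show ?case
    unfolding step eword_r_word[OF assms(1) m(4,2)]
  proof
    fix j
    consider "j \<le> c + 2 * t" | "j = Suc (c + 2 * t)" | "j = ?m" | "?m < j \<and> j \<le> n - 2"
      | "j = n - 1" | "j = n" | "n < j" using m by linarith
    then show "(if j = ?m - 1 then z (n - 1) else if j = ?m then z n
      else if ?m < j \<and> j \<le> n - 2 then z (j - 2) else if j = n - 1 then - z (n - 2)
      else if j = n then - z (n - 3) else z j) =
      (if j \<le> c then y j
        else if j \<le> c + 2 * Suc t then - y (n + c + 1 - j) else if j \<le> n - 2 then y (j - 2 * Suc t)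
        else if j = n - 1 then - y (n - 2 * Suc t) else if j = n then - y (n - 2 * Suc t - 1) else y j)"
    proof cases
      case 1
      then show ?thesis using z_low[OF 1] m by auto
    next
      case 2
      have "n + c + 1 - j = n - 2 * t" using 2 m by simp
      then show ?thesis using 2 unfolding z_end by simp
    next
      case 3
      have "n + c + 1 - j = n - 2 * t - 1" using 3 m by simp
      then show ?thesis using 3 unfolding z_end by simp
    next
      case 4
      then have "c + 2 * t < j - 2" "j - 2 \<le> n - 2" by auto
      then have "z (j - 2) = y (j - 2 * Suc t)" using z_mid[of "j - 2"] by (simp add: diff_right_commute)
      then show ?thesis using 4 by simp
    next
      case 5
      have "c + 2 * t < n - 2" using m by auto
      then have "z (n - 2) = y (n - 2 * Suc t)" using z_mid[of "n - 2"] by (simp add: diff_right_commute)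
      then show ?thesis using 5 m assms(1) by auto
    next
      case 6
      have "c + 2 * t < n - 3" "n - 3 \<le> n - 2" using m by auto
      then have "z (n - 3) = y (n - 3 - 2 * t)" by (rule z_mid)
      moreover have "n - 3 - 2 * t = n - 2 * Suc t - 1" by simp
      ultimately have "z (n - 3) = y (n - 2 * Suc t - 1)" by (simp only:)
      then show ?thesis using 6 m assms(1) by auto
    next
      case 7
      then show ?thesis using z_out m assms(1) by auto
    qed
  qed
qed

lemma set_r_words: "1 \<le> n \<Longrightarrow> 2 \<le> b \<Longrightarrow> set (r_words n a b) \<subseteq> {1..n}"
  by (auto simp: r_words_def r_word_def seg_def)

text \<open>The quadratic is the sum of the lengths 2(n-m)+1 of the factors \<open>r_m\<close>;
  integers avoid truncated subtraction.\<close>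

lemma length_r_words:
  "c + 2 * t \<le> n - 2 \<Longrightarrow>
    int (length (r_words n (c + 2 * t) (c + 2))) = int t * (2 * (int n - int c) - 2 * int t - 1)"
proof (induction t)
  case 0
  then show ?case by (simp add: r_words_less)
next
  case (Suc t)
  have "c + 2 * Suc t = Suc (Suc (c + 2 * t))" by simp
  moreover have "int (length (r_word n (Suc (Suc (c + 2 * t))))) = 2 * (int n - int c - 2 * int t - 2) + 1"
    using Suc.prems by (simp add: r_word_def seg_def of_nat_diff)
  ultimately show ?case using Suc by (simp add: r_words_step algebra_simps)
qed

section \<open>Reduced expressions\<close>

lemma emb_delta_eq:
  assumes "4 \<le> n"
  shows "emb n (delta n) = (\<lambda>k. if k = 0 then 1 else 0)"
proof
  fix k
  consider "k = 0" | "1 \<le> k" "k \<le> n" | "n < k" by linarith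
  then show "emb n (delta n) k = (if k = 0 then 1 else 0)"
    by cases (auto simp: emb_delta[OF assms] emb_beyond, simp add: delta_def)
qed

lemma pairing_omega:
  assumes "1 \<le> i" "i \<le> n"
  shows "pairing n (\<lambda>j. if j = i then 1 else 0) v = v i - v 0 * delta n i"
proof -
  have "pairing n (\<lambda>j. if j = i then 1 else 0) v = (\<Sum>j=1..n. if j = i then v i - v 0 * delta n i else 0)"
    unfolding pairing_def by (intro sum.cong) auto
  then show ?thesis using assms by simp
qed

lemma omega_eq:
  assumes "1 \<le> i" "i \<le> n"
  shows "omega n i v = (\<lambda>k. v k - (v i - v 0 * delta n i) * delta n k)"
  unfolding omega_def translation_pairing pairing_omega[OF assms] ..

lemma emb_omega:
  assumes "4 \<le> n" "1 \<le> i" "i \<le> n - 2"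
  shows "emb n (omega n i v) = (emb n v)(0 := emb n v 0 - (\<Sum>k=1..i. emb n v k))"
proof -
  have "i \<le> n" using assms(3) by simp
  then show ?thesis
    unfolding omega_eq[OF assms(2) \<open>i \<le> n\<close>] emb_diff emb_delta_eq[OF assms(1)] partial_sum[OF assms]
    by (auto simp: fun_eq_iff)
qed

text \<open>Here \<open>\<pi>\<^sub>i\<close> is obtained as \<open>\<omega>\<^sub>i u\<^sup>-\<^sup>1\<close>: the word \<open>u\<close> permutes the simple roots up to the
  same multiples of \<open>\<delta>\<close> that \<open>\<omega>\<^sub>i\<close> subtracts.\<close>

lemma pi_elt_from_word:
  assumes n: "4 \<le> n" and i: "1 \<le> i" "i \<le> n" "delta n i = 1" and u: "set u \<subseteq> {1..n}"
    and t: "\<And>m. m \<le> n \<Longrightarrow> t m \<le> n" "t i = 0"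
    and root: "\<And>m. m \<le> n \<Longrightarrow> eword n u (eroot n m) =
      (eroot n (t m))(0 := eroot n (t m) 0 - (if m = i then 1 else if m = 0 then - 1 else 0))"
  shows "pi_elt n i \<in> Lam n" and "pi_elt n i v = omega n i (word_prod n (rev u) v)"
proof -
  define x where "x = (\<lambda>v. omega n i (word_prod n (rev u) v))"
  define c :: "nat \<Rightarrow> int" where "c m = (if m = i then 1 else if m = 0 then - 1 else 0)" for m
  have u0: "set u \<subseteq> {0..n}" "set (rev u) \<subseteq> {1..n}" using u by auto
  have x_root: "x (simple_root (t m)) = simple_root m" if m: "m \<le> n" for m
  proof -
    have "emb n (word_prod n u (simple_root m)) =
        (eroot n (t m))(0 := eroot n (t m) 0 - c m)"
      by (simp only: emb_word[OF u0(1)] emb_simple_root[OF m] root[OF m] c_def)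
    also have "\<dots> = (\<lambda>k. eroot n (t m) k - c m * (if k = 0 then 1 else 0))"
      by (simp add: fun_eq_iff)
    also have "\<dots> = emb n (\<lambda>k. simple_root (t m) k - c m * delta n k)"
      by (simp only: emb_diff emb_simple_root[OF t(1)[OF m]] emb_delta_eq[OF n])
    finally have "word_prod n u (simple_root m) = (\<lambda>k. simple_root (t m) k - c m * delta n k)"
      by (rule emb_inject[OF n])
    then have r: "simple_root m = (\<lambda>k. word_prod n (rev u) (simple_root (t m)) k - c m * delta n k)"
      using word_prod_rev[OF n u0(1), of "simple_root m"] by (simp only: word_prod_sub_delta[OF n])
    define y where "y = word_prod n (rev u) (simple_root (t m))"
    have y: "y k = simple_root m k + c m * delta n k" for k
      using fun_cong[OF r, of k] by (simp add: y_def)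
    \<comment> \<open>As \<open>delta n i\<close> is 1, this difference is the multiple of \<delta>
      that \<omega>_i subtracts from y; the \<delta>-parts of the two entries cancel.\<close>
    have "y i - y 0 = c m" using i by (auto simp: y unit_vec_def c_def)
    then have "x (simple_root (t m)) k = simple_root m k" for k
      unfolding x_def omega_eq[OF i(1,2)] y_def[symmetric] i(3) by (simp add: y)
    then show ?thesis by (rule ext)
  qed
  have ext: "x \<in> ext_affine_weyl n"
  proof -
    obtain d where d: "\<And>v. translation n (\<lambda>j. if j = i then 1 else 0) (word_prod n (rev u) v) =
        word_prod n (rev u) (translation n d v)"
      using translation_word[OF n u0(2), of "\<lambda>j. if j = i then 1 else 0"] by (elim exE) (rule that, blast)
    show ?thesis
      by (rule ext_affine_weylI[OF u0(2)]) (simp only: x_def omega_def d)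
  qed
  \<comment> \<open>x sends \<alpha>_{t m} to \<alpha>_m, so t is injective on the finite set of
    nodes and hence a permutation.\<close>
  have surj: "t ` {0..n} = {0..n}"
  proof (rule endo_inj_surj)
    show "t ` {0..n} \<subseteq> {0..n}" by (intro image_subsetI) (simp add: t(1))
    show "inj_on t {0..n}"
    proof (rule inj_onI)
      fix m m' assume m: "m \<in> {0..n}" "m' \<in> {0..n}" and eq: "t m = t m'"
      have le: "m \<le> n" "m' \<le> n" using m by auto
      have "simple_root m = simple_root m'"
        using x_root[OF le(1)] x_root[OF le(2)] unfolding eq by (rule trans[OF sym])
      then have "unit_vec m m = unit_vec m' m" by (rule fun_cong)
      then show "m = m'" by (simp add: unit_vec_def split: if_splits)
    qed
  qed simp
  have "x ` simple_root ` {0..n} = x ` simple_root ` t ` {0..n}" unfolding surj ..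
  also have "\<dots> = (\<lambda>m. x (simple_root (t m))) ` {0..n}" by (simp only: image_image)
  also have "\<dots> = simple_root ` {0..n}" by (rule image_cong) (simp_all add: x_root)
  finally have perm: "x ` simple_root ` {0..n} = simple_root ` {0..n}" .
  have "x \<in> Lam n" unfolding Lam_def using ext perm by (intro CollectI conjI)
  moreover have "x (simple_root 0) = simple_root i" using x_root[OF i(2)] unfolding t(2) .
  ultimately have pi: "pi_elt n i = x" by (rule pi_elt_eqI[OF n])
  show "pi_elt n i \<in> Lam n" unfolding pi by fact
  show "pi_elt n i v = omega n i (word_prod n (rev u) v)" unfolding pi x_def ..
qed

section \<open>Indexing and counting the roots made negative\<close>

definition two_term :: "nat \<Rightarrow> nat \<Rightarrow> int \<Rightarrow> int \<Rightarrow> vec" where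
  "two_term b a s d = (\<lambda>k. if k = 0 then d else if k = a then 1 else if k = b then s else 0)"

text \<open>Quadruples (b, a, s, d) encode d \<delta> + e_a + s e_b. The larger index b stands
  first, so that index sets are sums over b of ranges for a, and cardinalities are computed on the
  indices.\<close>

definition root_set :: "(nat \<times> nat \<times> int \<times> int) set \<Rightarrow> vec set" where
  "root_set K = (\<lambda>(b, a, s, d). two_term b a s d) ` K"

lemma is_root_two_term:
  assumes "1 \<le> a" "a < b" "b \<le> n" "s = 1 \<or> s = - 1"
  shows "is_root n (two_term b a s d)"
proof -
  have "ip n (two_term b a s d) (two_term b a s d) =
      (\<Sum>k=1..n. (if k = a then 1 else 0) + (if k = b then 1 else 0))"
    unfolding ip_def using assms by (intro sum.cong) (auto simp: two_term_def)
  also have "\<dots> = 2" using assms by (simp add: sum.distrib)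
  finally show ?thesis using assms by (auto simp: is_root_def two_term_def)
qed

lemma lexpos_two_term: "1 \<le> a \<Longrightarrow> a < b \<Longrightarrow> 0 \<le> d \<Longrightarrow> lexpos (two_term b a s d)"
  by (rule lexposI[of _ "if d = 0 then a else 0"]) (auto simp: two_term_def split: if_splits)

lemma two_term_inject:
  assumes "two_term b a s d = two_term b' a' s' d'" "1 \<le> a" "a < b" "1 \<le> a'" "a' < b'" "s \<noteq> 0" "s' \<noteq> 0"
  shows "b = b' \<and> a = a' \<and> s = s' \<and> d = d'"
proof -
  have e: "two_term b a s d k = two_term b' a' s' d' k" for k using assms(1) by simp
  have "{k. 0 < k \<and> two_term b a s d k \<noteq> 0} = {a, b}" "{k. 0 < k \<and> two_term b' a' s' d' k \<noteq> 0} = {a', b'}"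
    using assms(2-7) by (auto simp: two_term_def)
  then have "{a, b} = {a', b'}" unfolding e by simp
  then have "a = a' \<and> b = b'" using assms(2-5) by (auto simp: doubleton_eq_iff)
  then show ?thesis using e[of b] e[of 0] assms(2-5) by (simp add: two_term_def)
qed

lemma card_root_set:
  assumes "\<And>b a s d. (b, a, s, d) \<in> K \<Longrightarrow> 1 \<le> a \<and> a < b \<and> (s = 1 \<or> s = - 1)"
  shows "card (root_set K) = card K"
  unfolding root_set_def
proof (rule card_image, rule inj_onI)
  fix p q
  assume pq: "p \<in> K" "q \<in> K"
    "(case p of (b, a, s, d) \<Rightarrow> two_term b a s d) = (case q of (b, a, s, d) \<Rightarrow> two_term b a s d)"
  obtain b a s d b' a' s' d' where p: "p = (b, a, s, d)" and q: "q = (b', a', s', d')"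
    by (cases p, cases q) auto
  have "b = b' \<and> a = a' \<and> s = s' \<and> d = d'"
    using assms[of b a s d] assms[of b' a' s' d'] pq unfolding p q
    by (intro two_term_inject) auto
  then show "p = q" unfolding p q by simp
qed

lemma reduced_by_root_set:
  assumes "4 \<le> n" "lam \<in> Lam n" "set u \<subseteq> {0..n}" "x = lam \<circ> word_prod n u"
    and "finite K" "length u \<le> card K"
    and K: "\<And>b a s d. (b, a, s, d) \<in> K \<Longrightarrow> 1 \<le> a \<and> a < b \<and> b \<le> n \<and> (s = 1 \<or> s = - 1) \<and> 0 \<le> d
      \<and> lexneg (eword n u (two_term b a s d))"
  shows "reduced_expression n x lam u"
proof (rule reduced_expressionI[OF assms(1-4)])
  show "finite (root_set K)" using assms(5) by (simp add: root_set_def)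
  have "card (root_set K) = card K" by (rule card_root_set) (use K in blast)
  then show "length u \<le> card (root_set K)" using assms(6) by simp
  fix y assume "y \<in> root_set K"
  then obtain b a s d where y: "(b, a, s, d) \<in> K" "y = two_term b a s d"
    by (auto simp: root_set_def)
  show "is_root n y \<and> lexpos y \<and> lexneg (eword n u y)"
    using K[OF y(1)] unfolding y(2) by (blast intro: is_root_two_term lexpos_two_term)
qed

lemma sum_pred_double: "2 * (\<Sum>b=1..m. b - 1) = m * (m - 1)" for m :: nat
proof (induction m)
  case (Suc m)
  then show ?case by (cases m) auto
qed simp

text \<open>The positive roots d \<delta> + \<gamma> that \<omega>_i makes negative, that is, with d
  below the pairing of \<omega>_i and \<gamma>. For i <= n-2 this pairing is 1 if \<gamma> is e_a +
  e_b or e_a - e_b with a <= i < b, and 2 if \<gamma> = e_a + e_b with a < b <= i.\<close>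

definition low_roots :: "nat \<Rightarrow> nat \<Rightarrow> (nat \<times> nat \<times> int \<times> int) set" where
  "low_roots n i = {i + 1..n} \<times> {1..i} \<times> {1, - 1} \<times> {0} \<union> (SIGMA b:{1..i}. {1..<b} \<times> {1} \<times> {0, 1})"

lemma finite_low_roots: "finite (low_roots n i)"
  by (auto simp: low_roots_def)

lemma card_low_roots: "card (low_roots n i) = (n - i) * i * 2 + i * (i - 1)"
proof -
  have 1: "card ({i + 1..n} \<times> {1..i} \<times> {1, - 1 :: int} \<times> {0 :: int}) = (n - i) * i * 2"
    by (simp add: card_cartesian_product)
  have "card (SIGMA b:{1..i}. {1..<b} \<times> {1 :: int} \<times> {0, 1 :: int}) =
      (\<Sum>b=1..i. card ({1..<b} \<times> {1 :: int} \<times> {0, 1 :: int}))"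
    by (rule card_SigmaI) auto
  also have "\<dots> = (\<Sum>b=1..i. 2 * (b - 1))"
    by (intro sum.cong refl) (simp add: card_cartesian_product)
  also have "\<dots> = i * (i - 1)"
    using sum_pred_double[of i] by (simp add: sum_distrib_left)
  finally show ?thesis
    unfolding low_roots_def by (subst card_Un_disjoint) (auto simp: 1 simp del: One_nat_def)
qed

lemma sum_two_term:
  assumes "1 \<le> l" "1 \<le> a" "a < b"
  shows "(\<Sum>k=l..i. two_term b a s d k) = (if l \<le> a \<and> a \<le> i then 1 else 0) + (if l \<le> b \<and> b \<le> i then s else 0)"
proof -
  have "(\<Sum>k=l..i. two_term b a s d k) = (\<Sum>k=l..i. (if k = a then 1 else 0) + (if k = b then s else 0))"
    using assms by (intro sum.cong) (auto simp: two_term_def)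
  then show ?thesis by (simp add: sum.distrib)
qed

lemma id_in_Lam: "id \<in> Lam n"
proof -
  have "id \<in> ext_affine_weyl n"
    by (rule ext_affine_weylI[of "[]" _ _ "\<lambda>_. 0"]) (simp_all add: translation_zero)
  then show ?thesis by (simp add: Lam_def)
qed

lemma length_word_pow: "length (word_pow w m) = m * length w"
  by (induction m) auto

lemma set_word_pow: "set (word_pow w m) \<subseteq> set w"
  by (induction m) auto

lemma length_rot_word: "4 \<le> n \<Longrightarrow> length (rot_word n) = 2 * (n - 1)"
  by (simp add: rot_word_def seg_def Suc_diff_le) arith

lemma reduced_even:
  assumes n: "4 \<le> n" and i: "1 \<le> i" "i \<le> n - 2" "even i"
  shows "reduced_expression n (omega n i) id (word_pow (rot_word n) (i div 2) @ segs n i)" (is "reduced_expression _ _ _ ?u")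
proof -
  have "i \<le> n" using i(2) by simp
  have set_u: "set ?u \<subseteq> {0..n}"
    using set_word_pow[of "rot_word n" "i div 2"] set_seg_chain[of "n - i" i n] n \<open>i \<le> n\<close>
    by (auto simp: rot_word_def seg_def segs_chain subset_iff)
  have act: "eword n ?u y = y(0 := y 0 - (\<Sum>k=1..i. y k))" for y
    by (rule eword_even_case[OF n i(1) \<open>i \<le> n\<close> i(3)])
  show ?thesis
  proof (rule reduced_by_root_set[OF n id_in_Lam set_u])
    show "omega n i = id \<circ> word_prod n ?u"
    proof
      fix v
      show "omega n i v = (id \<circ> word_prod n ?u) v"
        by (rule emb_inject[OF n]) (simp only: emb_omega[OF n i(1,2)] id_comp emb_word[OF set_u] act)
    qed
    show "finite (low_roots n i)" by (rule finite_low_roots)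
    obtain m where m: "i = 2 * m" using i(3) by blast
    \<comment> \<open>The slack in i <= n-2; substituting n = i + p + 2 clears the truncated
      subtractions from the length identity.\<close>
    define p where "p = n - i - 2"
    have p: "n = i + p + 2" using i(2) n by (simp add: p_def)
    have "length ?u = m * (2 * (n - 1)) + (n - i) * i"
      using n m \<open>i \<le> n\<close> by (simp add: length_word_pow length_rot_word segs_chain length_seg_chain)
    also have "\<dots> = (n - i) * i * 2 + i * (i - 1)"
      unfolding p m by (cases m) (auto simp: algebra_simps)
    finally show "length ?u \<le> card (low_roots n i)" unfolding card_low_roots by simp
  next
    fix b a s d assume "(b, a, s, d) \<in> low_roots n i"
    then have "(i < b \<and> b \<le> n \<and> 1 \<le> a \<and> a \<le> i \<and> (s = 1 \<or> s = - 1) \<and> d = 0)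
        \<or> (b \<le> i \<and> 1 \<le> a \<and> a < b \<and> s = 1 \<and> (d = 0 \<or> d = 1))"
      by (auto simp: low_roots_def)
    \<comment> \<open>The \<delta>-coefficient drops by 1 in the first family and by 2 in the
      second, each time by more than d.\<close>
    moreover from this have "(eword n ?u (two_term b a s d)) 0 < 0"
      unfolding act using sum_two_term[of 1 a b s d i] by (auto simp: two_term_def)
    then have "lexneg (eword n ?u (two_term b a s d))" by (rule lexnegI) simp
    ultimately show "1 \<le> a \<and> a < b \<and> b \<le> n \<and> (s = 1 \<or> s = - 1) \<and> 0 \<le> d
      \<and> lexneg (eword n ?u (two_term b a s d))"
      using \<open>i \<le> n\<close> by auto
  qed
qed


section \<open>Odd i up to n-2 and the automorphism \<pi>_1\<close>

lemma eroot_0: "4 \<le> n \<Longrightarrow> eroot n 0 = (\<lambda>k. if k = 0 then 1 else if k = 1 \<or> k = 2 then - 1 else 0)"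
  by (auto simp: fun_eq_iff eroot_def finite_part_def unit_vec_def)

lemma eroot_mid: "1 \<le> m \<Longrightarrow> m < n \<Longrightarrow> eroot n m = (\<lambda>k. if k = m then 1 else if k = m + 1 then - 1 else 0)"
  by (auto simp: fun_eq_iff eroot_def finite_part_def unit_vec_def)

lemma eroot_n: "4 \<le> n \<Longrightarrow> eroot n n = (\<lambda>k. if k = n - 1 \<or> k = n then 1 else 0)"
  by (auto simp: fun_eq_iff eroot_def finite_part_def unit_vec_def)

lemma eroot_pred_n: "4 \<le> n \<Longrightarrow> eroot n (n - 1) = (\<lambda>k. if k = n - 1 then 1 else if k = n then - 1 else 0)"
  by (auto simp: fun_eq_iff eroot_def finite_part_def unit_vec_def)

lemma set_signed_rot: "4 \<le> n \<Longrightarrow> set (seg 1 (n - 2) @ [n]) \<subseteq> {1..n}"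
  by (auto simp: seg_def)

lemma length_signed_rot: "4 \<le> n \<Longrightarrow> length (seg 1 (n - 2) @ [n]) = n - 1"
  by (simp add: seg_def) arith

lemma set_segs: "i \<le> n \<Longrightarrow> set (segs n i) \<subseteq> {1..n}"
  using set_seg_chain[of "n - i" i n] by (simp add: segs_chain del: One_nat_def)

text \<open>u is the word of the odd formula for i = 1, so \<pi>_1 is recovered as \<omega>_1
  u^{-1}.\<close>

lemma pi_elt_1:
  assumes n: "4 \<le> n"
  defines "u \<equiv> (seg 1 (n - 2) @ [n]) @ segs n 1"
  shows "pi_elt n 1 \<in> Lam n" and "pi_elt n 1 v = omega n 1 (word_prod n (rev u) v)"
    and "eword n (rev u) y = y(1 := - y 1, n := - y n)" and "set u \<subseteq> {1..n}"
proof -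
  show u: "set u \<subseteq> {1..n}"
    unfolding u_def set_append using set_signed_rot[OF n] set_segs[of 1 n] n by simp
  have act: "eword n u y = y(1 := - y 1, n := - y n)" for y
    using eword_odd_case[OF n, of 1 y] n by (simp add: u_def)
  \<comment> \<open>\<open>pi_elt_from_word\<close> expects the node permutation of \<pi>_1^{-1};
    being an involution, \<pi>_1 has the same one.\<close>
  define t where "t m = (if m = 0 then 1 else if m = 1 then 0 else if m = n - 1 then n
    else if m = n then n - 1 else m)" for m
  have root: "eword n u (eroot n m) =
      (eroot n (t m))(0 := eroot n (t m) 0 - (if m = 1 then 1 else if m = 0 then - 1 else 0))" if m: "m \<le> n" for m
  proof -
    consider "m = 0" | "m = 1" | "m = n - 1" | "m = n" | "2 \<le> m \<and> m \<le> n - 2" using m by linarith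
    then show ?thesis
    proof cases
      case 1
      then have tm: "t m = 1" by (simp add: t_def)
      show ?thesis unfolding act tm unfolding 1 using n by (auto simp: eroot_0 eroot_mid fun_eq_iff)
    next
      case 2
      then have tm: "t m = 0" by (simp add: t_def)
      show ?thesis unfolding act tm unfolding 2 using n by (auto simp: eroot_0 eroot_mid fun_eq_iff)
    next
      case 3
      have tm: "t m = n" using n 3 by (simp add: t_def)
      show ?thesis unfolding act tm unfolding 3 eroot_n[OF n] eroot_pred_n[OF n]
        using n by (auto simp: fun_eq_iff)
    next
      case 4
      have tm: "t m = n - 1" using n 4 by (simp add: t_def)
      show ?thesis unfolding act tm unfolding 4 eroot_n[OF n] eroot_pred_n[OF n]
        using n by (auto simp: fun_eq_iff)
    next
      case 5
      then have tm: "t m = m" and m: "1 \<le> m" "m < n" using n by (auto simp: t_def)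
      show ?thesis unfolding act tm eroot_mid[OF m] using n 5 by (auto simp: fun_eq_iff)
    qed
  qed
  have d1: "delta n 1 = 1" using n by (simp add: delta_def)
  have t_le: "t m \<le> n" if "m \<le> n" for m using that n by (simp add: t_def)
  have t1: "t 1 = 0" by (simp add: t_def)
  have "1 \<le> n" using n by simp
  note pi = pi_elt_from_word[OF n order_refl this d1 u t_le t1 root]
  show "pi_elt n 1 \<in> Lam n" by (rule pi)
  show "pi_elt n 1 v = omega n 1 (word_prod n (rev u) v)" by (rule pi)
  have "eword n u (y(1 := - y 1, n := - y n)) = y" using n by (auto simp: act fun_eq_iff)
  moreover have "set u \<subseteq> {0..n}" using u by auto
  ultimately show "eword n (rev u) y = y(1 := - y 1, n := - y n)"
    using eword_rev[OF n, of u "y(1 := - y 1, n := - y n)"] by simp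
qed

lemma reduced_odd:
  assumes n: "4 \<le> n" and i: "1 \<le> i" "i \<le> n - 2" "odd i"
  shows "reduced_expression n (omega n i) (pi_elt n 1)
    ((seg 1 (n - 2) @ [n]) @ word_pow (rot_word n) ((i - 1) div 2) @ segs n i)" (is "reduced_expression _ _ _ ?u")
proof -
  have "i \<le> n" using i(2) by simp
  have "set (rot_word n) \<subseteq> {0..n}" using n by (auto simp: rot_word_def seg_def)
  moreover have "{1..n} \<subseteq> {0..n}" by auto
  ultimately have set_u: "set ?u \<subseteq> {0..n}"
    using set_word_pow[of "rot_word n" "(i - 1) div 2"] set_signed_rot[OF n] set_segs[OF \<open>i \<le> n\<close>]
    unfolding set_append by blast
  have act: "eword n ?u y = y(0 := y 0 - (\<Sum>k=2..i. y k), 1 := - y 1, n := - y n)" for y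
    by (rule eword_odd_case[OF n i])
  show ?thesis
  proof (rule reduced_by_root_set[OF n pi_elt_1(1)[OF n] set_u])
    show "omega n i = pi_elt n 1 \<circ> word_prod n ?u"
    proof
      fix v
      let ?p = "(seg 1 (n - 2) @ [n]) @ segs n 1"
      \<comment> \<open>Unfolds \<pi>_1 as \<omega>_1 after the inverse of the word for i = 1. That
        inverse undoes the two sign changes of \<open>?u\<close>, and \<omega>_1 subtracts the entry
        x_1 that \<open>?u\<close> leaves out of the sum.\<close>
      define w where "w = word_prod n (rev ?p) (word_prod n ?u v)"
      have "set (rev ?p) \<subseteq> {0..n}" using pi_elt_1(4)[OF n] by (auto simp del: One_nat_def)
      then have "emb n w = eword n (rev ?p) (eword n ?u (emb n v))"
        unfolding w_def by (simp only: emb_word[OF set_u] emb_word)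
      also have "\<dots> = (emb n v)(0 := emb n v 0 - (\<Sum>k=2..i. emb n v k))"
        unfolding act pi_elt_1(3)[OF n] using n by (auto simp: fun_eq_iff)
      finally have w: "emb n w = \<dots>" .
      have "{1..i} = insert 1 {2..i}" using i(1) by auto
      then have s: "(\<Sum>k=1..i. emb n v k) = emb n v 1 + (\<Sum>k=2..i. emb n v k)" by simp
      have "emb n (omega n i v) = emb n (omega n 1 w)"
        unfolding emb_omega[OF n i(1,2)] s using n emb_omega[OF n, of 1 w] by (auto simp: w fun_eq_iff)
      then have "omega n i v = omega n 1 w" by (rule emb_inject[OF n])
      then show "omega n i v = (pi_elt n 1 \<circ> word_prod n ?u) v"
        using pi_elt_1(2)[OF n, of "word_prod n ?u v"] unfolding w_def o_def by (rule trans[OF _ sym])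
    qed
    show "finite (low_roots n i)" by (rule finite_low_roots)
    obtain m where m: "i = 2 * m + 1" using i(3) by (rule oddE)
    define p where "p = n - i - 2"
    have p: "n = i + p + 2" using i(2) n by (simp add: p_def)
    have "length ?u = (n - 1) + m * (2 * (n - 1)) + (n - i) * i"
      unfolding length_append[of "seg 1 (n - 2) @ [n]"] length_signed_rot[OF n] using n m \<open>i \<le> n\<close>
      by (simp add: length_word_pow length_rot_word segs_chain length_seg_chain)
    also have "\<dots> = (n - i) * i * 2 + i * (i - 1)"
      unfolding p m by (auto simp: algebra_simps)
    finally show "length ?u \<le> card (low_roots n i)" unfolding card_low_roots by simp
  next
    fix b a s d assume "(b, a, s, d) \<in> low_roots n i"
    then have K: "(i < b \<and> b \<le> n \<and> 1 \<le> a \<and> a \<le> i \<and> (s = 1 \<or> s = - 1) \<and> d = 0)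
        \<or> (b \<le> i \<and> 1 \<le> a \<and> a < b \<and> s = 1 \<and> (d = 0 \<or> d = 1))"
      by (auto simp: low_roots_def)
    then have ab: "1 \<le> a" "a < b" by auto
    let ?z = "eword n ?u (two_term b a s d)"
    have z0: "?z 0 = d - (if 2 \<le> a \<and> a \<le> i then 1 else 0) - (if 2 \<le> b \<and> b \<le> i then s else 0)"
      unfolding act using sum_two_term[of 2 a b s d i] ab n by (simp add: two_term_def)
    have z1: "?z 1 = - 1" if "a = 1"
      unfolding act using n that by (simp add: two_term_def)
    \<comment> \<open>If the \<delta>-coefficient does not become negative, the omitted entry 1 is
      responsible: then a = 1, and the sign change at 1 makes the image negative.\<close>
    have "lexneg ?z"
    proof (cases "?z 0 < 0")
      case True
      then show ?thesis by (rule lexnegI) simp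
    next
      case False
      then have "a = 1" "?z 0 = 0" using K z0 by (auto split: if_splits)
      then show ?thesis using z1 by (intro lexnegI[of _ 1]) auto
    qed
    then show "1 \<le> a \<and> a < b \<and> b \<le> n \<and> (s = 1 \<or> s = - 1) \<and> 0 \<le> d \<and> lexneg ?z"
      using K \<open>i \<le> n\<close> by auto
  qed
qed


section \<open>The spin nodes n-1 and n\<close>

text \<open>Common normal form of the four spin words: x is reversed and negated, except that the
  exchange of entries 1 and n has free signs. The sign a is -1 for i = n and 1 for i = n-1; b
  depends also on the parity of n.\<close>

definition flip_map :: "nat \<Rightarrow> int \<Rightarrow> int \<Rightarrow> oper" where
  "flip_map n a b y = (\<lambda>j. if j = 1 then a * y n else if j = n then b * y 1
    else if 1 < j \<and> j < n then - y (n + 1 - j) else y j)"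

lemma flip_map_simps:
  assumes "4 \<le> n"
  shows "flip_map n a b y 0 = y 0" "flip_map n a b y 1 = a * y n" "flip_map n a b y n = b * y 1"
    and "1 < j \<Longrightarrow> j < n \<Longrightarrow> flip_map n a b y j = - y (n + 1 - j)"
    and "n < j \<Longrightarrow> flip_map n a b y j = y j"
  using assms by (auto simp: flip_map_def)

lemma flip_map_eqI:
  assumes "4 \<le> n" "z 0 = y 0" "z 1 = a * y n" "z n = b * y 1"
    and "\<And>j. 1 < j \<Longrightarrow> j < n \<Longrightarrow> z j = - y (n + 1 - j)" "\<And>j. n < j \<Longrightarrow> z j = y j"
  shows "z = flip_map n a b y"
proof
  fix j
  consider "j = 0" | "j = 1" | "j = n" | "1 < j" "j < n" | "n < j" by linarith
  then show "z j = flip_map n a b y j"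
    by cases (simp_all only: assms flip_map_simps[OF assms(1)])
qed

lemma delta_spin: "4 \<le> n \<Longrightarrow> i = n - 1 \<or> i = n \<Longrightarrow> delta n i = 1"
  by (auto simp: delta_def)

lemma pi_elt_spin:
  assumes n: "4 \<le> n" and i: "i = n - 1 \<or> i = n" and u: "set u \<subseteq> {1..n}"
    and a: "a = (if i = n then - 1 else 1)" and b: "b = 1 \<or> b = - 1"
    and act: "\<And>y. eword n u y = flip_map n a b y"
  shows "pi_elt n i \<in> Lam n" and "pi_elt n i v = omega n i (word_prod n (rev u) v)"
proof -
  \<comment> \<open>The node permutation of \<pi>_i^{-1}: b decides where 0 and 1 go, a decides
    which of n-1 and n goes to 0.\<close>
  define t where "t m = (if m = 0 then (if b = - 1 then n else n - 1)
    else if m = 1 then (if b = - 1 then n - 1 else n)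
    else if m = n - 1 then (if a = 1 then 0 else 1) else if m = n then (if a = 1 then 1 else 0)
    else n - m)" for m
  have t_le: "t m \<le> n" if "m \<le> n" for m using that n by (simp add: t_def)
  have ti: "t i = 0" using i a n by (auto simp: t_def)
  have i1: "1 \<le> i" "i \<le> n" using i n by auto
  have root: "eword n u (eroot n m) =
      (eroot n (t m))(0 := eroot n (t m) 0 - (if m = i then 1 else if m = 0 then - 1 else 0))" if m: "m \<le> n" for m
  proof -
    define z where "z = (eroot n (t m))(0 := eroot n (t m) 0 - (if m = i then 1 else if m = 0 then - 1 else 0))"
    have z: "z 0 = eroot n (t m) 0 - (if m = i then 1 else if m = 0 then - 1 else 0)"
      "\<And>j. 1 \<le> j \<Longrightarrow> z j = eroot n (t m) j"
      by (simp_all add: z_def)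
    note er = eroot_0[OF n] eroot_n[OF n] eroot_pred_n[OF n, unfolded One_nat_def] eroot_mid
    have i0: "i \<noteq> 0" using i1 by simp
    consider "m = 0" | "m = 1" | "m = n - 1" | "m = n" | "2 \<le> m" "m \<le> n - 2" using m by linarith
    then have "z = flip_map n a b (eroot n m)"
    proof cases
      case 1
      then have tm: "t m = (if b = - 1 then n else n - 1)" by (simp add: t_def)
      show ?thesis
        by (rule flip_map_eqI[OF n]; use b n i0 in \<open>auto simp: z[unfolded tm, unfolded 1] er 1\<close>)
    next
      case 2
      then have tm: "t m = (if b = - 1 then n - 1 else n)" by (simp add: t_def)
      have "i \<noteq> 1" using i n by auto
      then show ?thesis
        by (intro flip_map_eqI[OF n]; use b n in \<open>auto simp: z[unfolded tm, unfolded 2] er 2\<close>)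
    next
      case 3
      then have "m \<noteq> 0" "m \<noteq> 1" using n by auto
      then have tm: "t m = (if a = 1 then 0 else 1)" using 3 by (simp add: t_def)
      show ?thesis
        by (rule flip_map_eqI[OF n]; use a i n in \<open>auto simp: z[unfolded tm, unfolded 3] er 3 split: if_splits\<close>)
    next
      case 4
      then have "m \<noteq> 0" "m \<noteq> 1" "m \<noteq> n - 1" using n by auto
      then have tm: "t m = (if a = 1 then 1 else 0)" using 4 by (simp add: t_def)
      show ?thesis
        by (rule flip_map_eqI[OF n]; use a i n in \<open>auto simp: z[unfolded tm, unfolded 4] er 4 split: if_splits\<close>)
    next
      case 5
      then have tm: "t m = n - m" and mi: "m \<noteq> i" "m \<noteq> 0" "1 \<le> m" "m < n" "1 \<le> n - m" "n - m < n"
        using n i by (auto simp: t_def)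
      show ?thesis
        by (rule flip_map_eqI[OF n]; use 5 n mi in \<open>auto simp: z[unfolded tm] eroot_mid\<close>)
    qed
    then show ?thesis unfolding act z_def by (rule sym)
  qed
  note pi = pi_elt_from_word[OF n i1 delta_spin[OF n i] u t_le ti root]
  show "pi_elt n i \<in> Lam n" by (rule pi)
  show "pi_elt n i v = omega n i (word_prod n (rev u) v)" by (rule pi)
qed

text \<open>The roots that pair to 1 with \<omega>_i, where -a is the sign of e_n in \<omega>_i. No
  finite root pairs to more, so d = 0 throughout.\<close>

definition spin_roots :: "nat \<Rightarrow> int \<Rightarrow> (nat \<times> nat \<times> int \<times> int) set" where
  "spin_roots n a = (SIGMA q:{1..n}. {1..<q} \<times> {if q = n then - a else 1} \<times> {0})"

lemma card_spin_roots: "2 * card (spin_roots n a) = n * (n - 1)"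
proof -
  have "card (spin_roots n a) = (\<Sum>q=1..n. card ({1..<q} \<times> {if q = n then - a else 1} \<times> {0 :: int}))"
    unfolding spin_roots_def by (rule card_SigmaI) auto
  also have "\<dots> = (\<Sum>q=1..n. q - 1)"
    by (intro sum.cong refl) (simp add: card_cartesian_product)
  finally show ?thesis using sum_pred_double[of n] by simp
qed

lemma reduced_spin:
  assumes n: "4 \<le> n" and i: "i = n - 1 \<or> i = n" and u: "set u \<subseteq> {1..n}"
    and a: "a = (if i = n then - 1 else 1)" and b: "b = 1 \<or> b = - 1"
    and act: "\<And>y. eword n u y = flip_map n a b y"
    and len: "2 * length u = n * (n - 1)"
  shows "reduced_expression n (omega n i) (pi_elt n i) u"
proof -
  have u0: "set u \<subseteq> {0..n}" using u by auto
  note pi = pi_elt_spin[OF n i u a b act]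
  show ?thesis
  proof (rule reduced_by_root_set[OF n pi(1) u0])
    show "omega n i = pi_elt n i \<circ> word_prod n u"
    proof
      show "omega n i v = (pi_elt n i \<circ> word_prod n u) v" for v
        unfolding o_def pi(2) word_prod_rev[OF n u0] ..
    qed
    show "finite (spin_roots n a)" by (auto simp: spin_roots_def)
    show "length u \<le> card (spin_roots n a)" using len card_spin_roots[of n a] by linarith
  next
    fix q p s d assume "(q, p, s, d) \<in> spin_roots n a"
    then have K: "1 \<le> p" "p < q" "q \<le> n" "s = (if q = n then - a else 1)" "d = 0"
      by (auto simp: spin_roots_def)
    have a1: "a = 1 \<or> a = - 1" using a by simp
    let ?z = "eword n u (two_term q p s d)"
    \<comment> \<open>Reversal takes the larger position q to the smaller position n+1-q, so the
      image has its first nonzero entry there.\<close>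
    have low: "?z j = 0" if "j < n + 1 - q" for j
    proof -
      consider "j = 0" | "j = 1" | "1 < j" by linarith
      then show ?thesis
      proof cases
        case 1
        then show ?thesis using K(5) unfolding act by (simp add: flip_map_simps(1)[OF n] two_term_def)
      next
        case 2
        then have "q \<noteq> n" "p \<noteq> n" using that K(2,3) by auto
        then show ?thesis unfolding act 2 flip_map_simps(2)[OF n] using n by (simp add: two_term_def)
      next
        case 3
        then have "j < n" "n + 1 - j > q" using that K(1,2) by auto
        then show ?thesis unfolding act flip_map_simps(4)[OF n 3 \<open>j < n\<close>] using K(2) by (simp add: two_term_def)
      qed
    qed
    have "?z (n + 1 - q) = - 1"
    proof (cases "q = n")
      case True
      \<comment> \<open>At q = n the sign a of the map meets the sign -a of the root.\<close>
      have "a * a = 1" using a1 by auto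
      moreover have "n + 1 - q = 1" using True by simp
      moreover have "two_term q p s d n = - a" using True K n by (simp add: two_term_def)
      ultimately show ?thesis unfolding act by (simp add: flip_map_simps(2)[OF n, unfolded One_nat_def])
    next
      case False
      have "1 < n + 1 - q" "n + 1 - q < n" "n + 1 - (n + 1 - q) = q" using False K(1-3) by auto
      then show ?thesis unfolding act using False K by (simp add: flip_map_simps(4)[OF n] two_term_def)
    qed
    then have "lexneg ?z" using low by (intro lexnegI[of _ "n + 1 - q"]) auto
    then show "1 \<le> p \<and> p < q \<and> q \<le> n \<and> (s = 1 \<or> s = - 1) \<and> 0 \<le> d \<and> lexneg ?z"
      using K a1 by auto
  qed
qed

lemma eword_last_two:
  assumes "4 \<le> n"
  shows "eword n [n - 1, n - 2] y = y(n - 2 := y (n - 1), n - 1 := y n, n := y (n - 2))"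
proof -
  have e: "n - 2 + 1 = n - 1" "n - 1 + 1 = n" using assms by auto
  have "eword n [n - 1, n - 2] y = erefl n (n - 1) (erefl n (n - 2) y)" by simp
  also have "erefl n (n - 2) y = y(n - 2 := y (n - 1), n - 1 := y (n - 2))"
    using erefl_mid[OF assms, of "n - 2" y] assms unfolding e by simp
  also have "erefl n (n - 1) \<dots> = y(n - 2 := y (n - 1), n - 1 := y n, n := y (n - 2))"
    using erefl_mid[OF assms, of "n - 1" "y(n - 2 := y (n - 1), n - 1 := y (n - 2))"] assms
    unfolding e by (auto simp: fun_eq_iff)
  finally show ?thesis .
qed

text \<open>The \<open>r\<^sub>m\<close> move coordinates in pairs, so for one parity of \<open>n\<close> they leave a coordinate over, which
  \<open>s\<^bsub>n-1\<^esub>s\<^bsub>n-2\<^esub>\<close> carries to the last position.\<close>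

lemma eword_r_words_full:
  assumes "4 \<le> n" "n = c + 2 * t + 2"
  shows "eword n (r_words n (n - 2) (c + 2) @ [n]) y =
    (\<lambda>j. if c < j \<and> j \<le> n then - y (n + c + 1 - j) else y j)"
proof -
  have e: "n - 2 = c + 2 * t" "c + 2 * t \<le> n - 2" using assms by auto
  show ?thesis
    unfolding e(1) eword_r_words[OF assms(1) e(2)]
    using assms(2) by (auto simp: fun_eq_iff intro!: arg_cong[of _ _ y])
qed

lemma eword_r_words_partial:
  assumes "4 \<le> n" "n = c + 2 * t + 3"
  shows "eword n ([n - 1, n - 2] @ r_words n (n - 3) (c + 2) @ [n]) y =
    (\<lambda>j. if c < j \<and> j < n then - y (n + c + 1 - j) else if j = n then y (c + 1) else y j)"
proof -
  have e: "n - 3 = c + 2 * t" "c + 2 * t \<le> n - 2" using assms by auto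
  show ?thesis
    unfolding e(1) eword_append[of n "[n - 1, n - 2]"] eword_r_words[OF assms(1) e(2)] eword_last_two[OF assms(1)]
    using assms(2) by (auto simp: fun_eq_iff)
qed


lemma eword_seg_full:
  assumes "4 \<le> n"
  shows "eword n (seg 1 (n - 1)) y = (\<lambda>j. if j = 1 then y n else if 1 < j \<and> j \<le> n then y (j - 1) else y j)"
proof -
  have e: "Suc (n - 1) = n" using assms by simp
  show ?thesis by (rule eword_seg[OF assms, of 1 "n - 1" y, unfolded e]) (use assms in simp_all)
qed

lemma set_seg: "1 \<le> k \<Longrightarrow> l \<le> n \<Longrightarrow> set (seg k l) \<subseteq> {1..n}"
  by (auto simp: seg_def)

lemma length_r_words_full:
  assumes "n = c + 2 * t + 2"
  shows "int (length (r_words n (n - 2) (c + 2))) = int t * (2 * int t + 3)"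
proof -
  have e: "n - 2 = c + 2 * t" "c + 2 * t \<le> n - 2" using assms by auto
  show ?thesis unfolding e(1) length_r_words[OF e(2)] using assms by (simp add: algebra_simps)
qed

lemma length_r_words_partial:
  assumes "n = c + 2 * t + 3"
  shows "int (length (r_words n (n - 3) (c + 2))) = int t * (2 * int t + 5)"
proof -
  have e: "n - 3 = c + 2 * t" "c + 2 * t \<le> n - 2" using assms by auto
  show ?thesis unfolding e(1) length_r_words[OF e(2)] using assms by (simp add: algebra_simps)
qed

lemma index_sums:
  "(0 :: nat) + 2 = 2" "(1 :: nat) + 2 = 3" "(0 :: nat) + 1 = 1" "(1 :: nat) + 1 = 2"
  "k + 0 + 1 = k + (1 :: nat)" "k + 1 + 1 = k + (2 :: nat)"
  by simp_all

lemma reduced_last_even: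
  assumes n: "4 \<le> n" "even n"
  shows "reduced_expression n (omega n n) (pi_elt n n) (r_words n (n - 2) 2 @ [n])" (is "reduced_expression _ _ _ ?u")
proof -
  obtain m where "n = 2 * m" using n(2) by blast
  then have nt: "n = 0 + 2 * (m - 1) + 2" using n(1) by simp
  define t where "t = m - 1"
  note nt = nt[folded t_def]
  have w: "eword n ?u y = (\<lambda>j. if 0 < j \<and> j \<le> n then - y (n + 1 - j) else y j)" for y
    by (rule eword_r_words_full[OF n(1) nt, unfolded index_sums])
  show ?thesis
  proof (rule reduced_spin[OF n(1), of n ?u "- 1" "- 1"])
    show "set ?u \<subseteq> {1..n}" using set_r_words[of n 2 "n - 2"] n(1) by simp
    show "eword n ?u y = flip_map n (- 1) (- 1) y" for y
      unfolding w using n(1) by (intro flip_map_eqI) auto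
    have "int (2 * length ?u) = int (n * (n - 1))"
      using length_r_words_full[OF nt, unfolded index_sums] nt by (simp add: algebra_simps)
    then show "2 * length ?u = n * (n - 1)" by (simp only: of_nat_eq_iff)
  qed auto
qed

lemma reduced_last_odd:
  assumes n: "4 \<le> n" "odd n"
  shows "reduced_expression n (omega n n) (pi_elt n n) ([n - 1, n - 2] @ r_words n (n - 3) 2 @ [n])" (is "reduced_expression _ _ _ ?u")
proof -
  obtain m where "n = 2 * m + 1" using n(2) by (rule oddE)
  then have nt: "n = 0 + 2 * (m - 1) + 3" using n(1) by simp
  define t where "t = m - 1"
  note nt = nt[folded t_def]
  have w: "eword n ?u y = (\<lambda>j. if 0 < j \<and> j < n then - y (n + 1 - j) else if j = n then y 1 else y j)" for y
    by (rule eword_r_words_partial[OF n(1) nt, unfolded index_sums])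
  \<comment> \<open>The entry left over reaches position n without a sign, hence b = 1.\<close>
  show ?thesis
  proof (rule reduced_spin[OF n(1), of n ?u "- 1" 1])
    show "set ?u \<subseteq> {1..n}" using set_r_words[of n 2 "n - 3"] n(1) by auto
    show "eword n ?u y = flip_map n (- 1) 1 y" for y
      unfolding w using n(1) by (intro flip_map_eqI) auto
    have "int (2 * length ?u) = int (n * (n - 1))"
      using length_r_words_partial[OF nt, unfolded index_sums] nt by (simp add: algebra_simps)
    then show "2 * length ?u = n * (n - 1)" by (simp only: of_nat_eq_iff)
  qed auto
qed

text \<open>The segment [1,n-1] acts first and brings the last entry to position 1, where c = 1
  keeps it away from the \<open>r_m\<close>; the other n-1 entries, an even number, are processed in
  pairs.\<close>

lemma reduced_penultimate_odd:
  assumes n: "4 \<le> n" "odd n"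
  shows "reduced_expression n (omega n (n - 1)) (pi_elt n (n - 1)) (r_words n (n - 2) 3 @ [n] @ seg 1 (n - 1))"
    (is "reduced_expression _ _ _ ?u")
proof -
  obtain m where "n = 2 * m + 1" using n(2) by (rule oddE)
  then have nt: "n = 1 + 2 * (m - 1) + 2" using n(1) by simp
  define t where "t = m - 1"
  note nt = nt[folded t_def]
  have w: "eword n ?u y = (\<lambda>j. if 1 < j \<and> j \<le> n then - x (n + 2 - j) else x j)"
    if "x = eword n (seg 1 (n - 1)) y" for x y
  proof -
    have "eword n ?u y = eword n (r_words n (n - 2) 3 @ [n]) x" unfolding that by (simp only: eword_append)
    also note eword_r_words_full[OF n(1) nt, unfolded index_sums]
    finally show ?thesis .
  qed
  show ?thesis
  proof (rule reduced_spin[OF n(1), of "n - 1" ?u 1 "- 1"])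
    show "set ?u \<subseteq> {1..n}"
      using set_r_words[of n 3 "n - 2"] set_seg[of 1 "n - 1" n] n(1) by (simp del: One_nat_def)
    show "eword n ?u y = flip_map n 1 (- 1) y" for y
      unfolding w[OF refl] eword_seg_full[OF n(1)]
      by (rule flip_map_eqI[OF n(1)]) (use n(1) in \<open>auto intro!: arg_cong[of _ _ y]\<close>)
    have "int (2 * length ?u) = int (n * (n - 1))"
      using length_r_words_full[OF nt, unfolded index_sums] nt by (simp add: seg_def algebra_simps)
    then show "2 * length ?u = n * (n - 1)" by (simp only: of_nat_eq_iff)
  qed (use n(1) in auto)
qed

text \<open>Again position 1 is set aside by c = 1, but n-1 is now odd: one entry is left over, and
  the two-letter prefix carries it to the end.\<close>

lemma reduced_penultimate_even:
  assumes n: "4 \<le> n" "even n"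
  shows "reduced_expression n (omega n (n - 1)) (pi_elt n (n - 1))
    ([n - 1, n - 2] @ r_words n (n - 3) 3 @ [n] @ seg 1 (n - 1))" (is "reduced_expression _ _ _ ?u")
proof -
  obtain m where "n = 2 * m" using n(2) by blast
  then have nt: "n = 1 + 2 * (m - 2) + 3" using n(1) by simp
  define t where "t = m - 2"
  note nt = nt[folded t_def]
  have w: "eword n ?u y = (\<lambda>j. if 1 < j \<and> j < n then - x (n + 2 - j) else if j = n then x 2 else x j)"
    if "x = eword n (seg 1 (n - 1)) y" for x y
  proof -
    have "eword n ?u y = eword n ([n - 1, n - 2] @ r_words n (n - 3) 3 @ [n]) x" unfolding that by (simp only: eword_append)
    also note eword_r_words_partial[OF n(1) nt, unfolded index_sums]
    finally show ?thesis .
  qed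
  show ?thesis
  proof (rule reduced_spin[OF n(1), of "n - 1" ?u 1 1])
    show "set ?u \<subseteq> {1..n}"
      using set_r_words[of n 3 "n - 3"] set_seg[of 1 "n - 1" n] n(1) by auto
    show "eword n ?u y = flip_map n 1 1 y" for y
      unfolding w[OF refl] eword_seg_full[OF n(1)]
      by (rule flip_map_eqI[OF n(1)]) (use n(1) in \<open>auto intro!: arg_cong[of _ _ y]\<close>)
    have "int (2 * length ?u) = int (n * (n - 1))"
      using length_r_words_partial[OF nt, unfolded index_sums] nt by (simp add: seg_def algebra_simps)
    then show "2 * length ?u = n * (n - 1)" by (simp only: of_nat_eq_iff)
  qed (use n(1) in auto)
qed

theorem proposition3p4:
  fixes n i :: nat
  assumes "n \<ge> 4" and "1 \<le> i" and "i \<le> n"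
  shows
    "(even i \<longrightarrow>
        (i \<le> n - 2 \<longrightarrow>
           reduced_expression n (omega n i) id
             (word_pow ([0] @ seg 2 (n - 1) @ seg 1 (n - 2) @ [n]) (i div 2) @ segs n i)) \<and>
        (i = n - 1 \<longrightarrow>
           reduced_expression n (omega n i) (pi_elt n (n - 1))
             (r_words n (n - 2) 3 @ [n] @ seg 1 (n - 1))) \<and>
        (i = n \<longrightarrow>
           reduced_expression n (omega n i) (pi_elt n n)
             (r_words n (n - 2) 2 @ [n]))) \<and>
     (odd i \<longrightarrow>
        (i \<le> n - 2 \<longrightarrow>
           reduced_expression n (omega n i) (pi_elt n 1)
             (seg 1 (n - 2) @ [n] @
              word_pow ([0] @ seg 2 (n - 1) @ seg 1 (n - 2) @ [n]) ((i - 1) div 2) @ segs n i)) \<and>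
        (i = n - 1 \<longrightarrow>
           reduced_expression n (omega n i) (pi_elt n (n - 1))
             ([n - 1, n - 2] @ r_words n (n - 3) 3 @ [n] @ seg 1 (n - 1))) \<and>
        (i = n \<longrightarrow>
           reduced_expression n (omega n i) (pi_elt n n)
             ([n - 1, n - 2] @ r_words n (n - 3) 2 @ [n])))"
proof -
  \<comment> \<open>For node n-1 the lemmas split on the parity of n, the theorem on that of
    i.\<close>
  have even_n: "even n \<longleftrightarrow> odd i" if "i = n - 1" using that assms(1) by auto
  show ?thesis
    using reduced_even[OF assms(1,2), unfolded rot_word_def]
      reduced_odd[OF assms(1,2), unfolded rot_word_def append_assoc]
      reduced_last_even[OF assms(1)] reduced_last_odd[OF assms(1)]
      reduced_penultimate_odd[OF assms(1)] reduced_penultimate_even[OF assms(1)] even_n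
    unfolding append_assoc by blast
qed

end
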